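(* There is an absolute constant $\alpha>0$ such that for all large enough $n\in\mathbb{N}$ there is an explicit monotone multilinear polynomial $F'\in\mathbb{Q}[x_1,\ldots,x_n]$ that cannot be written as a Hadamard product $F'=f_1\circ f_2$ of two monotone multilinear polynomials $f_1,f_2\in\mathbb{R}[x_1,\ldots,x_n]$ such that each $f_i$ is computed by a monotone circuit of size less than $2^{\alpha n}$.
   Context: Variables commute. Hadamard product: for polynomials $f=\sum_m a_m m$ and $g=\sum_m b_m m$ (sums over monomials $m$), $f\circ g=\sum_m a_m b_m m$. A polynomial is monotone if all its coefficients are nonnegative reals. An arithmetic circuit has $+$ and $\times$ gates and inputs that are variables or field constants. It is monotone if all its constants are nonnegative reals. The size of a circuit is its number of edges. A polynomial $f$ in $n$ variables (more precisely, a family of such polynomials indexed by $n$) is explicit if the coefficient in $f$ of any given monomial $m$ can be computed in time polynomial in $n$. *)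

theory Defs
  imports Complex_Main "HOL-Library.Poly_Mapping"
begin

section \<open>Polynomials\<close>

text \<open>A monomial is a finitely supported exponent vector; the variables
  $x_1,\ldots,x_n$ carry the indices $0,\ldots,n-1$.\<close>

type_synonym monomial = "nat \<Rightarrow>\<^sub>0 nat"
type_synonym 'a mpoly = "monomial \<Rightarrow>\<^sub>0 'a"

definition monomial_in :: "nat \<Rightarrow> monomial \<Rightarrow> bool" where
  "monomial_in n m \<longleftrightarrow> Poly_Mapping.keys m \<subseteq> {..<n}"

definition mpoly_in :: "nat \<Rightarrow> 'a::zero mpoly \<Rightarrow> bool" where
  "mpoly_in n f \<longleftrightarrow> (\<forall>m\<in>Poly_Mapping.keys f. monomial_in n m)"

definition multilinear :: "'a::zero mpoly \<Rightarrow> bool" where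
  "multilinear f \<longleftrightarrow> (\<forall>m\<in>Poly_Mapping.keys f. \<forall>i. Poly_Mapping.lookup m i \<le> 1)"

definition monotone_poly :: "'a::linordered_field mpoly \<Rightarrow> bool" where
  "monotone_poly f \<longleftrightarrow> (\<forall>m. 0 \<le> Poly_Mapping.lookup f m)"

lift_definition hadamard :: "('m \<Rightarrow>\<^sub>0 'a::mult_zero) \<Rightarrow> ('m \<Rightarrow>\<^sub>0 'a) \<Rightarrow> 'm \<Rightarrow>\<^sub>0 'a"
  is "\<lambda>f g m. f m * g m"
  by (auto elim: rev_finite_subset)

section \<open>Arithmetic circuits\<close>

text \<open>A circuit is a directed acyclic graph, given as the list of its nodes in a
  topological order: an argument of a node is the position of an earlier node. The last node is
  the output. Gates have arbitrary fan-in, and parallel edges are allowed and counted.\<close>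

datatype 'a gate = Var nat | Const 'a | Plus "nat list" | Times "nat list"

type_synonym 'a circuit = "'a gate list"

fun gate_args :: "'a gate \<Rightarrow> nat list" where
  "gate_args (Var i) = []"
| "gate_args (Const c) = []"
| "gate_args (Plus js) = js"
| "gate_args (Times js) = js"

definition circuit_in :: "nat \<Rightarrow> 'a circuit \<Rightarrow> bool" where
  "circuit_in n C \<longleftrightarrow> C \<noteq> [] \<and>
     (\<forall>k<length C. \<forall>j\<in>set (gate_args (C ! k)). j < k) \<and>
     (\<forall>i. Var i \<in> set C \<longrightarrow> i < n)"

fun gate_poly :: "'a::comm_semiring_1 mpoly list \<Rightarrow> 'a gate \<Rightarrow> 'a mpoly" where
  "gate_poly ps (Var i) = Poly_Mapping.single (Poly_Mapping.single i 1) 1"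
| "gate_poly ps (Const c) = Poly_Mapping.single 0 c"
| "gate_poly ps (Plus js) = (\<Sum>j\<leftarrow>js. ps ! j)"
| "gate_poly ps (Times js) = (\<Prod>j\<leftarrow>js. ps ! j)"

definition node_polys :: "'a::comm_semiring_1 circuit \<Rightarrow> 'a mpoly list" where
  "node_polys C = foldl (\<lambda>ps g. ps @ [gate_poly ps g]) [] C"

definition circuit_poly :: "'a::comm_semiring_1 circuit \<Rightarrow> 'a mpoly" where
  "circuit_poly C = last (node_polys C)"

definition circuit_size :: "'a circuit \<Rightarrow> nat" where
  "circuit_size C = (\<Sum>g\<leftarrow>C. length (gate_args g))"

definition monotone_circuit :: "'a::linordered_field circuit \<Rightarrow> bool" where
  "monotone_circuit C \<longleftrightarrow> (\<forall>c. Const c \<in> set C \<longrightarrow> 0 \<le> c)"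

section \<open>Polynomial-time computation and explicit families\<close>

text \<open>The machine model is the random access machine of Cook and Reckhow, with integer registers
  and unit cost. As addition and subtraction are the only arithmetic operations, a step increases
  the maximal bit length of the register contents by at most a constant depending on the program,
  so that polynomial time has the same meaning as for Turing machines. The machine halts when the
  program counter leaves the program; negative addresses are read as 0.\<close>

datatype instr =
    Set nat int
  | Add nat nat nat
  | Sub nat nat nat
  | Load nat nat
  | Store nat nat
  | JumpPos nat nat

type_synonym ram_config = "nat \<times> (nat \<Rightarrow> int)"

fun exec_instr :: "instr \<Rightarrow> ram_config \<Rightarrow> ram_config" where
  "exec_instr (Set i c) (pc, r) = (Suc pc, r(i := c))"
| "exec_instr (Add i j k) (pc, r) = (Suc pc, r(i := r j + r k))"
| "exec_instr (Sub i j k) (pc, r) = (Suc pc, r(i := r j - r k))"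
| "exec_instr (Load i j) (pc, r) = (Suc pc, r(i := r (nat (r j))))"
| "exec_instr (Store i j) (pc, r) = (Suc pc, r(nat (r i) := r j))"
| "exec_instr (JumpPos j l) (pc, r) = ((if r j > 0 then l else Suc pc), r)"

definition ram_step :: "instr list \<Rightarrow> ram_config \<Rightarrow> ram_config" where
  "ram_step P s = (if fst s < length P then exec_instr (P ! fst s) s else s)"

text \<open>Register 0 holds the number of variables, register $i$ for $1 \le i \le n$ the exponent of
  the $i$-th variable.\<close>

definition ram_input :: "nat \<Rightarrow> monomial \<Rightarrow> ram_config" where
  "ram_input n m =
     (0, \<lambda>i. if i = 0 then int n else if i \<le> n then int (Poly_Mapping.lookup m (i - 1)) else 0)"

text \<open>The output is the fraction with numerator in register 0 and denominator in register 1.\<close>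

definition ram_outputs_within :: "instr list \<Rightarrow> ram_config \<Rightarrow> nat \<Rightarrow> rat \<Rightarrow> bool" where
  "ram_outputs_within P s T q \<longleftrightarrow>
     (\<exists>t\<le>T. \<exists>pc r. (ram_step P ^^ t) s = (pc, r) \<and> length P \<le> pc \<and>
        r 1 > 0 \<and> q = of_int (r 0) / of_int (r 1))"

text \<open>One machine serves all members of the family.\<close>

definition explicit :: "(nat \<Rightarrow> rat mpoly) \<Rightarrow> bool" where
  "explicit F \<longleftrightarrow> (\<exists>P c d. \<forall>n m. monomial_in n m \<longrightarrow>
     ram_outputs_within P (ram_input n m) (c * n ^ d + c) (Poly_Mapping.lookup (F n) m))"

end

theory Submission
  imports Defs
begin

text \<open>Monotone circuits have no cancellations, so only supports matter. The support of a multilinear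
  polynomial with a small monotone circuit is a union of few rectangles, each with respect to a
  balanced partition of the variables. Hence the support of a Hadamard product is a union of few
  intersections of two rectangles, and each intersection contains, for every assignment of the
  variables outside two large disjoint sets $A$ and $D$, a rectangle over $A$ and $D$. The hard
  support is the zero set of the form $x_2 + \sum_{j<i} x_i x_j x_{s(i+j)}$ over the two-element
  field. The variables $x_{s(i+j)}$ have small indices and are shared by all pairs with about the
  same sum, so that restricting $i$ to $A$ and $j$ to $D$ yields a random Hankel matrix with
  linearly many rows and columns; its kernel has at most two elements on average, which forces the
  rectangles contained in the zero set to be exponentially small.\<close>

section \<open>Supports of monotone circuits\<close>

text \<open>Every pair of rectangles brings its own two partitions, so the form must be hard for all
  large disjoint \<open>A\<close> and \<open>D\<close> at once. With fixed coefficients this would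
  require a matrix all of whose large blocks have high rank. Here the remaining variables supply the
  matrix, and its rank is needed only on average, because the sizes are summed over all assignments.
  The constants fit as follows. Thirds in the balance condition leave two opposite blocks of at
  least n/6 indices. Sums i + j stay below 2n, so dividing by 16 puts the selectors below about n/8
  < n/6, and \<open>A\<close> and \<open>D\<close> can be cut down to indices above all selectors.
  The division merges neighbouring sums; keeping one residue class modulo 16 makes the selectors in
  a row distinct again at the price of a factor 16. This leaves k = n div 400 rows and columns. Two
  covers by s1 and s2 rectangles satisfy 2^k \<le> 4 * s1 * s2, and \<alpha> = 1/1000 stays below
  the resulting 1/800. The numbers 6, 7 and 17 in the form match the register layout of the machine
  for the coefficients.\<close>

lemma lookup_mult_eq_sum:
  fixes f g :: "'a::monoid_add \<Rightarrow>\<^sub>0 'b::semiring_0"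
  shows "Poly_Mapping.lookup (f * g) k =
    (\<Sum>(a, b)\<in>Poly_Mapping.keys f \<times> Poly_Mapping.keys g.
      if k = a + b then Poly_Mapping.lookup f a * Poly_Mapping.lookup g b else 0)"
proof -
  have "Poly_Mapping.lookup (f * g) k =
      (\<Sum>(a, b). Poly_Mapping.lookup f a * Poly_Mapping.lookup g b when k = a + b)"
    by (simp add: times_poly_mapping.rep_eq prod_fun_unfold_prod)
  also have "\<dots> = (\<Sum>(a, b)\<in>Poly_Mapping.keys f \<times> Poly_Mapping.keys g.
      Poly_Mapping.lookup f a * Poly_Mapping.lookup g b when k = a + b)"
    by (rule Sum_any.expand_superset)
      (auto simp: in_keys_iff when_def split: if_splits)
  finally show ?thesis by (simp add: when_def)
qed

lemma monotone_poly_single: "0 \<le> c \<Longrightarrow> monotone_poly (Poly_Mapping.single m c)"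
  by (simp add: monotone_poly_def lookup_single when_def)

lemma monotone_poly_add: "monotone_poly f \<Longrightarrow> monotone_poly g \<Longrightarrow> monotone_poly (f + g)"
  by (simp add: monotone_poly_def lookup_add)

lemma monotone_poly_mult:
  assumes "monotone_poly f" "monotone_poly g"
  shows "monotone_poly (f * g)"
  using assms by (auto simp: monotone_poly_def lookup_mult_eq_sum intro!: sum_nonneg)

lemma keys_add_monotone:
  assumes "monotone_poly f" "monotone_poly g"
  shows "Poly_Mapping.keys (f + g) = Poly_Mapping.keys f \<union> Poly_Mapping.keys g"
  using assms by (auto simp: monotone_poly_def in_keys_iff lookup_add add_nonneg_eq_0_iff)

text \<open>All products contributing to the coefficient of \<open>k\<close> are nonnegative and the
  one for the chosen pair is positive, so nothing cancels.\<close>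

lemma keys_mult_monotone:
  assumes "monotone_poly f" "monotone_poly g"
  shows "Poly_Mapping.keys (f * g) =
    {a + b | a b. a \<in> Poly_Mapping.keys f \<and> b \<in> Poly_Mapping.keys g}"
proof (intro equalityI keys_mult subsetI)
  fix k assume "k \<in> {a + b | a b. a \<in> Poly_Mapping.keys f \<and> b \<in> Poly_Mapping.keys g}"
  then obtain a b where ab: "a \<in> Poly_Mapping.keys f" "b \<in> Poly_Mapping.keys g" "k = a + b"
    by auto
  have nn: "0 \<le> Poly_Mapping.lookup f m" "0 \<le> Poly_Mapping.lookup g m" for m
    using assms by (auto simp: monotone_poly_def)
  have "0 < Poly_Mapping.lookup f a * Poly_Mapping.lookup g b"
    using ab nn[of a] nn[of b] by (simp add: in_keys_iff order_less_le)
  moreover have "Poly_Mapping.lookup (f * g) k > 0"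
    unfolding lookup_mult_eq_sum
    by (rule sum_pos2[where i = "(a, b)"]) (use ab nn calculation in auto)
  ultimately show "k \<in> Poly_Mapping.keys (f * g)"
    by (simp add: in_keys_iff)
qed

lemma monotone_poly_sum_list:
  "(\<And>j. j \<in> set js \<Longrightarrow> monotone_poly (p j)) \<Longrightarrow> monotone_poly (\<Sum>j\<leftarrow>js. p j)"
proof (induction js)
  case Nil
  then show ?case by (simp add: monotone_poly_def)
qed (auto intro!: monotone_poly_add)

lemma monotone_poly_prod_list:
  "(\<And>j. j \<in> set js \<Longrightarrow> monotone_poly (p j)) \<Longrightarrow> monotone_poly (\<Prod>j\<leftarrow>js. p j)"
proof (induction js)
  case Nil
  then show ?case by (simp add: monotone_poly_def lookup_one when_def)
qed (auto intro!: monotone_poly_mult)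

lemma keys_sum_list_monotone:
  "(\<And>j. j \<in> set js \<Longrightarrow> monotone_poly (p j)) \<Longrightarrow>
    Poly_Mapping.keys (\<Sum>j\<leftarrow>js. p j) = (\<Union>j\<in>set js. Poly_Mapping.keys (p j))"
  by (induction js) (simp_all add: keys_add_monotone monotone_poly_sum_list)

text \<open>Factors are indexed by position, so an argument that occurs twice may contribute two
  different monomials. The choices at different positions are independent, which later allows
  exchanging monomials factor by factor.\<close>

lemma keys_prod_list_monotone:
  fixes p :: "'i \<Rightarrow> 'a::linordered_field mpoly"
  shows "(\<And>j. j \<in> set js \<Longrightarrow> monotone_poly (p j)) \<Longrightarrow>
    Poly_Mapping.keys (\<Prod>j\<leftarrow>js. p j) =
      {\<Sum>i<length js. \<mu> i | \<mu>. \<forall>i<length js. \<mu> i \<in> Poly_Mapping.keys (p (js ! i))}"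
proof (induction js)
  case Nil
  then show ?case by auto
next
  case (Cons j js)
  have "Poly_Mapping.keys (\<Prod>j\<leftarrow>j # js. p j) =
     {a + b | a b. a \<in> Poly_Mapping.keys (p j) \<and> b \<in> Poly_Mapping.keys (\<Prod>j\<leftarrow>js. p j)}"
    using Cons.prems by (simp add: keys_mult_monotone monotone_poly_prod_list)
  also have "\<dots> = {\<Sum>i<length (j # js). \<mu> i | \<mu>.
      \<forall>i<length (j # js). \<mu> i \<in> Poly_Mapping.keys (p ((j # js) ! i))}" (is "?L = ?R")
  proof (intro equalityI subsetI)
    fix m assume "m \<in> ?L"
    then obtain a \<mu> where m: "a \<in> Poly_Mapping.keys (p j)"
        "\<forall>i<length js. \<mu> i \<in> Poly_Mapping.keys (p (js ! i))" "m = a + (\<Sum>i<length js. \<mu> i)"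
      using Cons by auto
    show "m \<in> ?R"
    proof (intro CollectI exI[of _ "case_nat a \<mu>"] conjI allI impI)
      show "m = (\<Sum>i<length (j # js). case_nat a \<mu> i)"
        using m by (simp only: length_Cons sum.lessThan_Suc_shift) simp
    qed (use m in \<open>auto simp: nth_Cons split: nat.splits\<close>)
  next
    fix m assume "m \<in> ?R"
    then obtain \<mu> where m: "\<forall>i<length (j # js). \<mu> i \<in> Poly_Mapping.keys (p ((j # js) ! i))"
        "m = (\<Sum>i<length (j # js). \<mu> i)" by auto
    have "m = \<mu> 0 + (\<Sum>i<length js. \<mu> (Suc i))"
      using m(2) by (simp only: length_Cons sum.lessThan_Suc_shift)
    moreover have "\<mu> 0 \<in> Poly_Mapping.keys (p j)"
      using m(1) by auto
    moreover have "\<forall>i<length js. \<mu> (Suc i) \<in> Poly_Mapping.keys (p (js ! i))"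
      using m(1) by auto
    ultimately show "m \<in> ?L" using Cons by auto
  qed
  finally show ?case .
qed

section \<open>Values of the nodes of a circuit\<close>

lemma length_foldl_append: "length (foldl (\<lambda>ps g. ps @ [h ps g]) qs C) = length qs + length C"
  by (induction C arbitrary: qs) auto

lemma length_node_polys [simp]: "length (node_polys C) = length C"
  by (simp add: node_polys_def length_foldl_append)

lemma node_polys_append: "\<exists>qs. node_polys (C @ D) = node_polys C @ qs"
proof (induction D rule: rev_induct)
  case (snoc g D)
  then obtain qs where "node_polys (C @ D) = node_polys C @ qs" by blast
  then have "node_polys (C @ D @ [g]) = node_polys C @ qs @ [gate_poly (node_polys (C @ D)) g]"
    by (simp add: node_polys_def)
  then show ?case by blast
qed simp

lemma gate_poly_append:
  "\<forall>j\<in>set (gate_args g). j < length ps \<Longrightarrow> gate_poly (ps @ qs) g = gate_poly ps g"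
  by (cases g) (auto simp: nth_append intro!: arg_cong[where f = sum_list] arg_cong[where f = prod_list])

text \<open>Node \<open>k\<close> is evaluated on the list of earlier values; as its arguments lie
  below \<open>k\<close>, the full list gives the same result. This replaces the fold by a local
  equation at each node.\<close>

lemma node_polys_nth:
  assumes "circuit_in n C" "k < length C"
  shows "node_polys C ! k = gate_poly (node_polys C) (C ! k)"
proof -
  have args: "\<forall>j\<in>set (gate_args (C ! k)). j < k"
    using assms by (auto simp: circuit_in_def)
  have C: "C = (take k C @ [C ! k]) @ drop (Suc k) C"
    using assms(2) by (simp add: id_take_nth_drop[symmetric])
  obtain qs where qs: "node_polys C = node_polys (take k C @ [C ! k]) @ qs"
    using node_polys_append C by metis
  have eq: "node_polys (take k C @ [C ! k]) =
      node_polys (take k C) @ [gate_poly (node_polys (take k C)) (C ! k)]"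
    by (simp add: node_polys_def)
  have len: "length (node_polys (take k C)) = k"
    using assms(2) by simp
  have "node_polys C ! k = gate_poly (node_polys (take k C)) (C ! k)"
    unfolding qs eq using len by (simp add: nth_append)
  also have "\<dots> = gate_poly (node_polys C) (C ! k)"
    unfolding qs eq append_assoc
    by (rule gate_poly_append[symmetric]) (use args len in simp)
  finally show ?thesis .
qed

lemma monotone_node_polys:
  fixes C :: "'a::linordered_field circuit"
  assumes "circuit_in n C" "monotone_circuit C" "k < length C"
  shows "monotone_poly (node_polys C ! k)"
  using assms(3)
proof (induction k rule: less_induct)
  case (less k)
  have args: "monotone_poly (node_polys C ! j)" if "j \<in> set (gate_args (C ! k))" for j
    using that less assms(1) by (auto simp: circuit_in_def)
  have "C ! k \<in> set C" using less.prems by simp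
  then have const: "0 \<le> c" if "C ! k = Const c" for c
    using assms(2) that by (simp add: monotone_circuit_def)
  have "monotone_poly (gate_poly (node_polys C) (C ! k))"
    using args const
    by (cases "C ! k")
      (simp_all add: monotone_poly_single monotone_poly_sum_list monotone_poly_prod_list)
  then show ?case
    using node_polys_nth[OF assms(1) less.prems] by simp
qed

section \<open>Rectangles and balanced sets of variables\<close>

definition mix :: "'i set \<Rightarrow> 'i set \<Rightarrow> 'i set \<Rightarrow> 'i set" where
  "mix Y x x' = (x \<inter> Y) \<union> (x' - Y)"

text \<open>Exchange form of a combinatorial rectangle: the traces on \<open>Y\<close> and the
  traces off \<open>Y\<close> combine freely.\<close>

definition mix_closed :: "'i set \<Rightarrow> 'i set set \<Rightarrow> bool" where
  "mix_closed Y R \<longleftrightarrow> (\<forall>x\<in>R. \<forall>x'\<in>R. mix Y x x' \<in> R)"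

definition balanced :: "nat \<Rightarrow> nat set \<Rightarrow> bool" where
  "balanced n Y \<longleftrightarrow> Y \<subseteq> {..<n} \<and> n \<le> 3 * card Y \<and> 3 * card Y \<le> 2 * n"

definition supports :: "'a::zero mpoly \<Rightarrow> nat set set" where
  "supports f = Poly_Mapping.keys ` Poly_Mapping.keys f"

lemma keys_add_nat:
  "Poly_Mapping.keys (p + q :: 'i \<Rightarrow>\<^sub>0 nat) = Poly_Mapping.keys p \<union> Poly_Mapping.keys q"
  by (auto simp: in_keys_iff lookup_add)

lemma keys_sum_nat:
  "finite I \<Longrightarrow> Poly_Mapping.keys (\<Sum>i\<in>I. \<mu> i :: 'i \<Rightarrow>\<^sub>0 nat) = (\<Union>i\<in>I. Poly_Mapping.keys (\<mu> i))"
  by (induction I rule: finite_induct) (simp_all add: keys_add_nat)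

text \<open>Either one weight alone lies between n/3 and 2n/3, or weights below n/3 are added until
  the sum first reaches n/3, when it is still below 2n/3.\<close>

lemma balanced_subfamily:
  fixes w :: "'i \<Rightarrow> nat"
  assumes "finite I" "\<And>i. i \<in> I \<Longrightarrow> 3 * w i \<le> 2 * n" "n \<le> 3 * sum w I"
  shows "\<exists>J\<subseteq>I. n \<le> 3 * sum w J \<and> 3 * sum w J \<le> 2 * n"
  using assms
proof (induction I rule: finite_induct)
  case empty
  then show ?case by auto
next
  case (insert i I)
  consider "n \<le> 3 * sum w I" | "3 * sum w I < n" "n \<le> 3 * w i" | "3 * sum w I < n" "3 * w i < n"
    by linarith
  then show ?case
  proof cases
    case 1
    then show ?thesis using insert by (meson insertI2 subset_insertI2)
  next
    case 2
    then show ?thesis using insert.prems by (intro exI[of _ "{i}"]) auto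
  next
    case 3
    then show ?thesis using insert by (intro exI[of _ "insert i I"]) auto
  qed
qed

text \<open>A set of floor(2n/3) elements fits in between; n \<ge> 2 makes this floor at least
  n/3.\<close>

lemma balanced_between:
  assumes "X \<subseteq> X'" "X' \<subseteq> {..<n}" "3 * card X \<le> 2 * n" "2 * n \<le> 3 * card X'" "2 \<le> n"
  shows "\<exists>Y. X \<subseteq> Y \<and> Y \<subseteq> X' \<and> balanced n Y"
proof -
  have "\<exists>Y. X \<subseteq> Y \<and> Y \<subseteq> X' \<and> card Y = 2 * n div 3"
    using assms by (intro exists_subset_between) (auto intro: finite_subset)
  then obtain Y where Y: "X \<subseteq> Y" "Y \<subseteq> X'" "card Y = 2 * n div 3" by blast
  have "n \<le> 3 * (2 * n div 3)" "3 * (2 * n div 3) \<le> 2 * n"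
    using assms(5) by presburger+
  then show ?thesis
    using Y assms(2) unfolding balanced_def by (metis order_trans)
qed


text \<open>For a node $u$ let $L_u$ be its set of monomials, and let the context of $u$ be the set of
  all $q$ with $p + q \in L_{\mathrm{root}}$ for all $p \in L_u$. Every monomial of the output is
  followed from the root downwards, always in the form $p + q$ with $p \in L_u$ and $q$ in the
  context of $u$, until the variables of $L_u$ drop to at most two thirds.\<close>

lemma supports_cover:
  fixes C :: "'a::linordered_field circuit"
  assumes n: "2 \<le> n" and C: "circuit_in n C" "monotone_circuit C"
    and f: "multilinear (circuit_poly C)" "mpoly_in n (circuit_poly C)"
  shows "\<exists>\<R>. finite \<R> \<and> card \<R> \<le> Suc (circuit_size C) \<and> \<Union>\<R> = supports (circuit_poly C) \<and>
    (\<forall>R\<in>\<R>. \<exists>Y. balanced n Y \<and> mix_closed Y R)"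
proof -
  define root where "root = length C - 1"
  define L where "L u = Poly_Mapping.keys (node_polys C ! u)" for u
  define X where "X u = (\<Union>p\<in>L u. Poly_Mapping.keys p)" for u
  define ctx where "ctx u = {q. \<forall>p\<in>L u. p + q \<in> L root}" for u
  define args where "args u = gate_args (C ! u)" for u
  define small where "small u \<longleftrightarrow> 3 * card (X u) \<le> 2 * n" for u
  define rect where "rect u v = {Poly_Mapping.keys (p + q) | p q. p \<in> L v \<and> q \<in> ctx u}" for u v
  have "C \<noteq> []" using C(1) by (simp add: circuit_in_def)
  moreover from this have "node_polys C \<noteq> []" by (metis length_0_conv length_node_polys)
  ultimately have root: "root < length C" "circuit_poly C = node_polys C ! root"
    by (simp_all add: root_def circuit_poly_def last_conv_nth)
  have args_less: "v < u" if "u < length C" "v \<in> set (args u)" for u v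
    using C(1) that by (auto simp: circuit_in_def args_def)
  have L_Plus: "L u = (\<Union>v\<in>set (args u). L v)" if "u < length C" "C ! u = Plus js" for u js
  proof -
    have "node_polys C ! u = (\<Sum>j\<leftarrow>js. node_polys C ! j)"
      using node_polys_nth[OF C(1) that(1)] that(2) by simp
    moreover have "monotone_poly (node_polys C ! j)" if "j \<in> set js" for j
      using that args_less[OF \<open>u < length C\<close>] \<open>u < length C\<close> \<open>C ! u = Plus js\<close>
      by (auto simp: args_def intro!: monotone_node_polys[OF C] intro: less_trans)
    ultimately show ?thesis
      using that by (simp add: L_def args_def keys_sum_list_monotone)
  qed
  have L_Times: "L u = {\<Sum>i<length (args u). \<mu> i | \<mu>. \<forall>i<length (args u). \<mu> i \<in> L (args u ! i)}"
    if "u < length C" "C ! u = Times js" for u js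
  proof -
    have "node_polys C ! u = (\<Prod>j\<leftarrow>js. node_polys C ! j)"
      using node_polys_nth[OF C(1) that(1)] that(2) by simp
    moreover have "monotone_poly (node_polys C ! j)" if "j \<in> set js" for j
      using that args_less[OF \<open>u < length C\<close>] \<open>u < length C\<close> \<open>C ! u = Times js\<close>
      by (auto simp: args_def intro!: monotone_node_polys[OF C] intro: less_trans)
    ultimately show ?thesis
      using that by (simp add: L_def args_def keys_prod_list_monotone)
  qed
  have root_le1: "Poly_Mapping.lookup m i \<le> 1" if "m \<in> L root" for m i
    using f(1) that root by (auto simp: multilinear_def L_def)
  have root_vars: "Poly_Mapping.keys m \<subseteq> {..<n}" if "m \<in> L root" for m
    using f(2) that root by (auto simp: mpoly_in_def monomial_in_def L_def)
  \<comment> \<open>Inner nodes are not assumed to be multilinear. Disjointness is available only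
    for summands of a monomial of the output, which is why nodes with empty context are treated
    separately below.\<close>
  have disj_add: "Poly_Mapping.keys p \<inter> Poly_Mapping.keys q = {}" if "p + q + r \<in> L root" for p q r
  proof (rule ccontr)
    assume "Poly_Mapping.keys p \<inter> Poly_Mapping.keys q \<noteq> {}"
    then obtain i where "Poly_Mapping.lookup p i \<noteq> 0" "Poly_Mapping.lookup q i \<noteq> 0"
      by (auto simp: in_keys_iff)
    then show False using root_le1[OF that, of i] by (simp add: lookup_add)
  qed
  have ctx_disj: "Poly_Mapping.keys q \<inter> X u = {}" if "q \<in> ctx u" for u q
    using that disj_add[of _ q 0] by (fastforce simp: X_def ctx_def)
  have X_sub: "X u \<subseteq> {..<n}" if "q \<in> ctx u" for u q
    using that root_vars by (fastforce simp: X_def ctx_def keys_add_nat)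
  have rect_sub: "rect u v \<subseteq> supports (circuit_poly C)" if "L v \<subseteq> L u" for u v
    using that by (auto simp: rect_def supports_def root ctx_def L_def)
  have ex_balanced: "\<exists>Y. balanced n Y"
    using balanced_between[of "{}" "{..<n}" n] n by auto

  \<comment> \<open>An edge from a large sum gate to a small child: monomials of the child live
    inside \<open>Y\<close>, contexts of the gate avoid \<open>X u\<close> and hence
    \<open>Y\<close>. Exchanging combines the child's monomial of one member with the context of the
    other.\<close>
  have plus_rect: "\<exists>Y. balanced n Y \<and> mix_closed Y (rect u v)"
    if uv: "L v \<subseteq> L u" "\<not> small u" "small v" for u v
  proof (cases "ctx u = {}")
    case True
    then show ?thesis using ex_balanced by (auto simp: rect_def mix_closed_def)
  next
    case False
    then obtain q0 where q0: "q0 \<in> ctx u" by blast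
    have "X v \<subseteq> X u" using uv(1) by (auto simp: X_def)
    then obtain Y where Y: "X v \<subseteq> Y" "Y \<subseteq> X u" "balanced n Y"
      using balanced_between[of "X v" "X u" n] X_sub[OF q0] uv n by (auto simp: small_def)
    have "mix Y (Poly_Mapping.keys (p + q)) (Poly_Mapping.keys (p' + q')) = Poly_Mapping.keys (p + q')"
      if "p \<in> L v" "q \<in> ctx u" "p' \<in> L v" "q' \<in> ctx u" for p q p' q'
    proof -
      have "Poly_Mapping.keys p \<subseteq> X v" "Poly_Mapping.keys p' \<subseteq> X v"
        using that by (auto simp: X_def)
      then show ?thesis
        using Y(1,2) ctx_disj[OF that(2)] ctx_disj[OF that(4)]
        unfolding mix_def keys_add_nat by blast
    qed
    then have "mix_closed Y (rect u v)"
      unfolding mix_closed_def rect_def by blast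
    then show ?thesis using Y(3) by blast
  qed

  \<comment> \<open>A large product gate whose children are all small: the children involve pairwise
    disjoint sets of variables, and some of these sets together form a balanced
    \<open>Y\<close>.\<close>
  have times_rect: "\<exists>Y. balanced n Y \<and> mix_closed Y (rect u u)"
    if u: "u < length C" "C ! u = Times js" "\<not> small u"
      and small: "\<And>v. v \<in> set (args u) \<Longrightarrow> small v" for u js
  proof (cases "ctx u = {} \<or> L u = {}")
    case True
    then show ?thesis using ex_balanced by (auto simp: rect_def mix_closed_def)
  next
    case False
    then obtain q0 p0 where q0: "q0 \<in> ctx u" and p0: "p0 \<in> L u" by blast
    define I where "I = {..<length (args u)}"
    define Z where "Z i = X (args u ! i)" for i
    have Lu: "L u = {\<Sum>i\<in>I. \<mu> i | \<mu>. \<forall>i\<in>I. \<mu> i \<in> L (args u ! i)}"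
      using L_Times[OF u(1,2)] by (simp add: I_def Ball_def)
    obtain \<mu>0 where \<mu>0: "\<forall>i\<in>I. \<mu>0 i \<in> L (args u ! i)"
      using p0 Lu by auto
    have [simp]: "finite I" by (simp add: I_def)
    \<comment> \<open>If two factors shared a variable, choosing monomials that contain it in both
      would square it in a monomial of the output.\<close>
    have disj: "Z i \<inter> Z j = {}" if ij: "i \<in> I" "j \<in> I" "i \<noteq> j" for i j
    proof (rule ccontr)
      assume "Z i \<inter> Z j \<noteq> {}"
      then obtain x a b where x: "a \<in> L (args u ! i)" "b \<in> L (args u ! j)"
          "x \<in> Poly_Mapping.keys a" "x \<in> Poly_Mapping.keys b"
        by (auto simp: Z_def X_def)
      define \<mu> where "\<mu> = \<mu>0(i := a, j := b)"
      have "(\<Sum>i\<in>I. \<mu> i) \<in> L u"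
        unfolding Lu using x \<mu>0 by (auto simp: \<mu>_def)
      then have "(\<Sum>i\<in>I. \<mu> i) + q0 \<in> L root"
        using q0 by (auto simp: ctx_def)
      moreover have "(\<Sum>i\<in>I. \<mu> i) = a + b + (\<Sum>i\<in>I - {i} - {j}. \<mu> i)"
        using ij by (simp add: sum.remove[of I i] sum.remove[of "I - {i}" j] \<mu>_def add.assoc)
      ultimately have "a + b + ((\<Sum>i\<in>I - {i} - {j}. \<mu> i) + q0) \<in> L root"
        by (simp add: add.assoc)
      then show False using disj_add x by blast
    qed
    have XZ: "X u = (\<Union>i\<in>I. Z i)"
    proof (intro equalityI subsetI)
      fix x assume "x \<in> X u"
      then show "x \<in> (\<Union>i\<in>I. Z i)"
        unfolding X_def Lu Z_def by (fastforce simp: keys_sum_nat)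
    next
      fix x assume "x \<in> (\<Union>i\<in>I. Z i)"
      then obtain i a where x: "i \<in> I" "a \<in> L (args u ! i)" "x \<in> Poly_Mapping.keys a"
        by (auto simp: Z_def X_def)
      then have "(\<Sum>j\<in>I. (\<mu>0(i := a)) j) \<in> L u"
        unfolding Lu using \<mu>0 by (intro CollectI exI[of _ "\<mu>0(i := a)"]) auto
      moreover have "x \<in> Poly_Mapping.keys (\<Sum>j\<in>I. (\<mu>0(i := a)) j)"
        using x by (auto simp: keys_sum_nat)
      ultimately show "x \<in> X u" unfolding X_def by blast
    qed
    have finZ: "finite (Z i)" if "i \<in> I" for i
      by (rule finite_subset[OF _ finite_lessThan[of n]]) (use X_sub[OF q0] XZ that in blast)
    have card_UN: "card (\<Union>i\<in>J. Z i) = (\<Sum>i\<in>J. card (Z i))" if "J \<subseteq> I" for J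
      using that disj finZ finite_subset[OF that \<open>finite I\<close>]
      by (intro card_UN_disjoint) (simp_all add: subset_iff)
    have "n \<le> 3 * (\<Sum>i\<in>I. card (Z i))"
      using u(3) by (simp add: small_def XZ card_UN)
    moreover have "3 * card (Z i) \<le> 2 * n" if "i \<in> I" for i
      using small[of "args u ! i"] that by (simp add: I_def Z_def small_def)
    ultimately obtain J where J: "J \<subseteq> I" "n \<le> 3 * (\<Sum>i\<in>J. card (Z i))"
        "3 * (\<Sum>i\<in>J. card (Z i)) \<le> 2 * n"
      using balanced_subfamily[of I "\<lambda>i. card (Z i)" n] by auto
    define Y where "Y = (\<Union>i\<in>J. Z i)"
    have "balanced n Y"
      using J X_sub[OF q0] XZ unfolding balanced_def Y_def card_UN[OF J(1)] by auto
    moreover have "mix_closed Y (rect u u)"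
      unfolding mix_closed_def
    proof (intro ballI)
      fix x x' assume "x \<in> rect u u" "x' \<in> rect u u"
      then obtain \<mu> q \<mu>' q' where x: "x = Poly_Mapping.keys ((\<Sum>i\<in>I. \<mu> i) + q)"
          "x' = Poly_Mapping.keys ((\<Sum>i\<in>I. \<mu>' i) + q')" "q \<in> ctx u" "q' \<in> ctx u"
          "\<forall>i\<in>I. \<mu> i \<in> L (args u ! i)" "\<forall>i\<in>I. \<mu>' i \<in> L (args u ! i)"
        unfolding rect_def Lu by auto
      \<comment> \<open>As \<open>Y\<close> consists of the variables of the factors in
        \<open>J\<close>, the exchange on \<open>Y\<close> is realised by taking the factors in
        \<open>J\<close> from the first member and the others, with the context, from the
        second.\<close>
      define \<nu> where "\<nu> i = (if i \<in> J then \<mu> i else \<mu>' i)" for i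
      have kq: "Poly_Mapping.keys q \<inter> (\<Union>i\<in>I. Z i) = {}" "Poly_Mapping.keys q' \<inter> (\<Union>i\<in>I. Z i) = {}"
        using ctx_disj[OF x(3)] ctx_disj[OF x(4)] XZ by simp_all
      have k: "Poly_Mapping.keys (\<mu> i) \<subseteq> Z i" "Poly_Mapping.keys (\<mu>' i) \<subseteq> Z i" if "i \<in> I" for i
        using x(5,6) that by (auto simp: Z_def X_def)
      have ZY: "Z i \<subseteq> Y" if "i \<in> J" for i using that by (auto simp: Y_def)
      have ZY': "Z i \<inter> Y = {}" if "i \<in> I" "i \<notin> J" for i
      proof -
        have "Z i \<inter> Z j = {}" if "j \<in> J" for j
          using disj[OF \<open>i \<in> I\<close>, of j] that J(1) \<open>i \<notin> J\<close> by auto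
        then show ?thesis by (auto simp: Y_def)
      qed
      have YI: "Y \<subseteq> (\<Union>i\<in>I. Z i)" using J(1) by (auto simp: Y_def)
      have qY: "Poly_Mapping.keys q \<inter> Y = {}" "Poly_Mapping.keys q' \<inter> Y = {}"
        using Int_mono[OF subset_refl[of "Poly_Mapping.keys q"] YI]
          Int_mono[OF subset_refl[of "Poly_Mapping.keys q'"] YI] by (simp_all only: kq subset_empty)
      have "Poly_Mapping.keys (\<nu> i) = (Poly_Mapping.keys (\<mu> i) \<inter> Y) \<union> (Poly_Mapping.keys (\<mu>' i) - Y)"
        if "i \<in> I" for i
        using k[OF that] ZY[of i] ZY'[OF that] unfolding \<nu>_def by (cases "i \<in> J") auto
      then have "(\<Union>i\<in>I. Poly_Mapping.keys (\<nu> i)) =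
          (\<Union>i\<in>I. (Poly_Mapping.keys (\<mu> i) \<inter> Y) \<union> (Poly_Mapping.keys (\<mu>' i) - Y))"
        by (rule SUP_cong[OF refl])
      also have "\<dots> = mix Y (\<Union>i\<in>I. Poly_Mapping.keys (\<mu> i)) (\<Union>i\<in>I. Poly_Mapping.keys (\<mu>' i))"
        by (auto simp: mix_def)
      finally have UN_\<nu>: "(\<Union>i\<in>I. Poly_Mapping.keys (\<nu> i)) = \<dots>" .
      have "mix Y (a \<union> Poly_Mapping.keys q) (b \<union> Poly_Mapping.keys q') = mix Y a b \<union> Poly_Mapping.keys q'"
        for a b
        using qY unfolding mix_def by blast
      then have "mix Y x x' = Poly_Mapping.keys ((\<Sum>i\<in>I. \<nu> i) + q')"
        unfolding x keys_add_nat keys_sum_nat[OF \<open>finite I\<close>] UN_\<nu> by simp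
      moreover have "(\<Sum>i\<in>I. \<nu> i) \<in> L u"
        unfolding Lu using x(5,6) by (auto simp: \<nu>_def)
      ultimately show "mix Y x x' \<in> rect u u"
        unfolding rect_def using x(4) by blast
    qed
    ultimately show ?thesis by blast
  qed

  define block where "block u j = (case C ! u of
      Plus js \<Rightarrow> if \<not> small u \<and> small (args u ! j) then rect u (args u ! j) else {}
    | Times js \<Rightarrow> if \<not> small u \<and> (\<forall>v\<in>set (args u). small v) then rect u u else {}
    | _ \<Rightarrow> {})" for u j
  \<comment> \<open>Blocks are charged to edges, which are counted by \<open>circuit_size\<close>; a
    product gate repeats its block on each of its edges. The \<open>Suc\<close> in the bound leaves
    room for the single set used when the root is already small.\<close>
  define E where "E = (SIGMA u:{..<length C}. {..<length (args u)})"
  define \<R> where "\<R> = (if small root then {supports (circuit_poly C)} else (\<lambda>(u, j). block u j) ` E)"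
  have "finite E" by (simp add: E_def)
  have "card E = circuit_size C"
    by (simp add: E_def args_def circuit_size_def sum_list_sum_nth atLeast0LessThan)
  then have "card \<R> \<le> Suc (circuit_size C)"
    using card_image_le[OF \<open>finite E\<close>, of "\<lambda>(u, j). block u j"] by (auto simp: \<R>_def)
  moreover have "finite \<R>" using \<open>finite E\<close> by (simp add: \<R>_def)
  moreover have "\<exists>Y. balanced n Y \<and> mix_closed Y R" if "R \<in> \<R>" for R
  proof (cases "small root")
    case True
    then have R: "R = supports (circuit_poly C)" using that by (simp add: \<R>_def)
    have "0 \<in> ctx root" by (simp add: ctx_def)
    \<comment> \<open>All variables of the output fit into a balanced \<open>Y\<close>, so the
      exchange returns its first argument.\<close>
    then obtain Y where Y: "X root \<subseteq> Y" "balanced n Y"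
      using balanced_between[of "X root" "{..<n}" n] X_sub True n by (auto simp: small_def)
    have "x \<subseteq> Y" if "x \<in> R" for x
      using that Y(1) by (auto simp: R supports_def X_def L_def root)
    then have "mix Y x x' = x" if "x \<in> R" "x' \<in> R" for x x'
      using that unfolding mix_def by blast
    then show ?thesis using Y(2) by (auto simp: mix_closed_def)
  next
    case False
    then have "R \<in> (\<lambda>(u, j). block u j) ` E" using that by (simp add: \<R>_def)
    then obtain u j where uj: "u < length C" "j < length (args u)" "R = block u j"
      unfolding E_def by blast
    have empty: "\<exists>Y. balanced n Y \<and> mix_closed Y {}" using ex_balanced by (simp add: mix_closed_def)
    show ?thesis
    proof (cases "C ! u")
      case (Plus js)
      have "L (args u ! j) \<subseteq> L u" using L_Plus[OF uj(1) Plus] uj(2) by auto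
      then show ?thesis using plus_rect empty uj(3) Plus by (auto simp: block_def)
    next
      case (Times js)
      then show ?thesis using times_rect[OF uj(1) Times] empty uj(3) by (auto simp: block_def)
    qed (use empty uj(3) in \<open>auto simp: block_def\<close>)
  qed
  moreover have "\<Union>\<R> = supports (circuit_poly C)"
  proof (cases "small root")
    case True
    then show ?thesis by (simp add: \<R>_def)
  next
    case False
    have "block u j \<subseteq> supports (circuit_poly C)" if "u < length C" "j < length (args u)" for u j
    proof (cases "C ! u")
      case (Plus js)
      have "L (args u ! j) \<subseteq> L u" using L_Plus[OF that(1) Plus] that(2) by auto
      then show ?thesis using rect_sub[of "args u ! j" u] Plus by (simp add: block_def)
    next
      case (Times js)
      then show ?thesis using rect_sub[of u u] by (simp add: block_def)
    qed (simp_all add: block_def)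
    \<comment> \<open>The descent runs through large nodes only. Inputs have at most one variable
      and are small because n \<ge> 2, so the descent must end at a block.\<close>
    moreover have "\<exists>u<length C. \<exists>j<length (args u). Poly_Mapping.keys (p + q) \<in> block u j"
      if "u < length C" "\<not> small u" "p \<in> L u" "q \<in> ctx u" for u p q
      using that
    proof (induction u arbitrary: p q rule: less_induct)
      case (less u)
      note u = less.prems(1)
      have vars: "X u \<subseteq> {..<n}" using X_sub less.prems(4) by blast
      show ?case
      proof (cases "C ! u")
        case (Var i)
        then have "L u = {Poly_Mapping.single i 1}"
          using node_polys_nth[OF C(1) u] by (simp add: L_def)
        then have "card (X u) \<le> 1" by (simp add: X_def)
        then show ?thesis using less.prems(2) n by (simp add: small_def)
      next
        case (Const c)
        then have "L u \<subseteq> {0}"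
          using node_polys_nth[OF C(1) u] by (simp add: L_def)
        then have "X u = {}" by (auto simp: X_def)
        then show ?thesis using less.prems(2) n by (simp add: small_def)
      next
        case (Plus js)
        then obtain v where v: "v \<in> set (args u)" "p \<in> L v"
          using L_Plus[OF u Plus] less.prems(3) by auto
        have sub: "L v \<subseteq> L u" using L_Plus[OF u Plus] v(1) by auto
        show ?thesis
        proof (cases "small v")
          case True
          obtain j where j: "j < length (args u)" "v = args u ! j"
            using v(1) by (metis in_set_conv_nth)
          have "Poly_Mapping.keys (p + q) \<in> block u j"
            using Plus less.prems j True v(2) by (auto simp: block_def rect_def)
          then show ?thesis using u j(1) by blast
        next
          case False
          have "q \<in> ctx v" using less.prems(4) sub by (auto simp: ctx_def)
          then show ?thesis
            using less.IH[OF args_less[OF u v(1)] _ False v(2)] args_less[OF u v(1)] u by simp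
        qed
      next
        case (Times js)
        have "args u \<noteq> []"
        proof
          assume "args u = []"
          then have "L u = {0}" using L_Times[OF u Times] by auto
          then have "X u = {}" by (auto simp: X_def)
          then show False using less.prems(2) n by (simp add: small_def)
        qed
        show ?thesis
        proof (cases "\<forall>v\<in>set (args u). small v")
          case True
          then have "Poly_Mapping.keys (p + q) \<in> block u 0"
            using Times less.prems by (auto simp: block_def rect_def)
          then show ?thesis using u \<open>args u \<noteq> []\<close> by blast
        next
          case False
          then obtain i where i: "i < length (args u)" "\<not> small (args u ! i)"
            by (metis in_set_conv_nth)
          obtain \<mu> where \<mu>: "p = (\<Sum>j<length (args u). \<mu> j)" "\<forall>j<length (args u). \<mu> j \<in> L (args u ! j)"
            using L_Times[OF u Times] less.prems(3) by auto
          define r where "r = (\<Sum>j\<in>{..<length (args u)} - {i}. \<mu> j)"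
          have p: "p = \<mu> i + r"
            unfolding \<mu>(1) r_def using i(1) by (simp add: sum.remove)
          \<comment> \<open>The other factors of \<open>p\<close> join the context: replacing the
            monomial of child \<open>i\<close> gives another monomial of \<open>u\<close>.\<close>
          have "r + q \<in> ctx (args u ! i)"
            unfolding ctx_def
          proof (intro CollectI ballI)
            fix a assume a: "a \<in> L (args u ! i)"
            have "(\<Sum>j<length (args u). (\<mu>(i := a)) j) = a + r"
              using i(1) by (simp add: sum.remove[of _ i] r_def)
            moreover have "(\<Sum>j<length (args u). (\<mu>(i := a)) j) \<in> L u"
              unfolding L_Times[OF u Times] using a \<mu>(2)
              by (intro CollectI exI[of _ "\<mu>(i := a)"]) auto
            ultimately have "(a + r) + q \<in> L root"
              using less.prems(4) by (simp add: ctx_def)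
            then show "a + (r + q) \<in> L root" by (simp add: add.assoc)
          qed
          moreover have "args u ! i < u" using args_less[OF u] i(1) by simp
          ultimately show ?thesis
            using less.IH[of "args u ! i" "\<mu> i" "r + q"] i \<mu>(2) u by (simp add: p add.assoc)
        qed
      qed
    qed
    \<comment> \<open>The context of the root contains 0, so the descent can start with the monomial
      itself.\<close>
    from this[OF root(1) False, of _ 0]
    have "\<exists>u<length C. \<exists>j<length (args u). Poly_Mapping.keys p \<in> block u j" if "p \<in> L root" for p
      using that by (simp add: ctx_def)
    ultimately show ?thesis
      using False by (fastforce simp: \<R>_def E_def supports_def root L_def)
  qed
  ultimately show ?thesis by blast
qed

section \<open>A cubic form with Hankel restrictions\<close>

text \<open>Of the 17, two units come from numbering registers from 1, and 15 rounds the division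
  up, as repeated subtraction of 16 does. The 6 puts the register of every selector above the
  working registers 0 to 7.\<close>

definition selector :: "nat \<Rightarrow> nat" where
  "selector w = 6 + (w + 17) div 16"

text \<open>Index \<open>j\<close> is held in register \<open>j + 1\<close>, so
  \<open>7 \<le> j\<close> selects the exponents stored beyond the working registers.\<close>

definition active_pairs :: "nat set \<Rightarrow> (nat \<times> nat) set" where
  "active_pairs x = {(i, j). i \<in> x \<and> j \<in> x \<and> 7 \<le> j \<and> j < i \<and> selector (i + j) \<in> x}"

text \<open>The parity of this number is the value of the form. Index 2 occurs in no pair and is no
  selector, so its linear term makes the form exactly balanced.\<close>

definition form_value :: "nat set \<Rightarrow> nat" where
  "form_value x = (if 2 \<in> x then 1 else 0) + card (active_pairs x)"

definition hard_family :: "nat \<Rightarrow> nat set set" where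
  "hard_family n = {x. x \<subseteq> {..<n} \<and> even (form_value x)}"

lemma selector_ge: "6 \<le> selector w"
  by (simp add: selector_def)

lemma selector_mono: "w \<le> w' \<Longrightarrow> selector w \<le> selector w'"
  by (simp add: selector_def div_le_mono)

lemma selector_less:
  assumes "i < n" "j < n"
  shows "selector (i + j) < n div 8 + 8"
proof -
  have "n < 8 * (n div 8) + 8"
    using mod_less_divisor[of 8 n] div_mult_mod_eq[of n 8] by linarith
  moreover have "i + j + 17 < (q + 2) * 16" if "n < 8 * q + 8" for q
    using that assms by simp
  ultimately have "i + j + 17 < (n div 8 + 2) * 16" by blast
  then show ?thesis
    using less_mult_imp_div_less[of "i + j + 17" "n div 8 + 2" 16] by (simp add: selector_def)
qed

text \<open>Distinct congruent indices differ by at least 16, so the quotient grows by at least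
  1.\<close>

lemma selector_strict_mono:
  assumes "a < a'" "a mod 16 = a' mod 16"
  shows "selector (a + d) < selector (a' + d)"
proof -
  have "16 dvd a' - a"
    using assms mod_eq_dvd_iff_nat[of a a' 16] by simp
  then have "a + 16 \<le> a'"
    using dvd_imp_le[of 16 "a' - a"] assms(1) by linarith
  have "Suc (selector (a + d)) = selector ((a + d) + 16)"
    using div_add_self2[of 16 "a + d + 17"] by (simp add: selector_def add.commute add.left_commute)
  also have "\<dots> \<le> selector (a' + d)"
    using \<open>a + 16 \<le> a'\<close> by (intro selector_mono) simp
  finally show ?thesis by simp
qed

lemma finite_active_pairs [simp]: "finite x \<Longrightarrow> finite (active_pairs x)"
  by (rule finite_subset[of _ "x \<times> x"]) (auto simp: active_pairs_def)

lemma form_value_toggle2: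
  assumes "finite x" "2 \<notin> x"
  shows "form_value (insert 2 x) = Suc (form_value x)"
proof -
  have "active_pairs (insert 2 x) = active_pairs x"
  proof -
    have "selector w \<noteq> 2" for w using selector_ge[of w] by simp
    then show ?thesis by (auto simp: active_pairs_def)
  qed
  then show ?thesis using assms by (simp add: form_value_def)
qed

text \<open>The involution \<open>t\<close> exchanges the members that satisfy \<open>P\<close> with
  those that do not.\<close>

lemma card_even_toggle:
  fixes P :: "'i set \<Rightarrow> bool"
  assumes "finite \<Z>" and tog: "\<And>z. z \<in> \<Z> \<Longrightarrow> t z \<in> \<Z> \<and> t (t z) = z \<and> (P (t z) \<longleftrightarrow> \<not> P z)"
  shows "2 * card {z \<in> \<Z>. P z} = card \<Z>"
proof -
  have "bij_betw t {z \<in> \<Z>. P z} {z \<in> \<Z>. \<not> P z}"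
    using tog by (intro bij_betw_byWitness[where f' = t]) auto
  then have "card {z \<in> \<Z>. \<not> P z} = card {z \<in> \<Z>. P z}"
    by (simp add: bij_betw_same_card)
  moreover have "card \<Z> = card {z \<in> \<Z>. P z} + card {z \<in> \<Z>. \<not> P z}"
    using assms(1) by (subst card_Un_disjoint[symmetric]) (auto intro!: arg_cong[where f = card])
  ultimately show ?thesis by simp
qed

definition toggle :: "'i \<Rightarrow> 'i set \<Rightarrow> 'i set" where
  "toggle i x = (if i \<in> x then x - {i} else insert i x)"

lemma toggle_toggle [simp]: "toggle i (toggle i x) = x"
  by (auto simp: toggle_def)

lemma card_hard_family:
  assumes "3 \<le> n"
  shows "2 * card (hard_family n) = 2 ^ n"
proof -
  have *: "even (form_value (toggle 2 x)) \<longleftrightarrow> odd (form_value x)" if "x \<subseteq> {..<n}" for x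
  proof (cases "2 \<in> x")
    case True
    then show ?thesis
      using form_value_toggle2[of "x - {2}"] that
      by (auto simp: toggle_def insert_absorb dest: finite_subset[OF _ finite_lessThan])
  next
    case False
    then show ?thesis
      using form_value_toggle2[of x] that
      by (auto simp: toggle_def dest: finite_subset[OF _ finite_lessThan])
  qed
  have "hard_family n = {x \<in> Pow {..<n}. even (form_value x)}"
    by (auto simp: hard_family_def)
  also have "2 * card \<dots> = card (Pow {..<n})"
    using * assms by (intro card_even_toggle[where t = "toggle 2"]) (auto simp: toggle_def split: if_splits)
  finally show ?thesis by (simp add: card_Pow)
qed

text \<open>The parity of its size is the derivative of the form in the variable \<open>d\<close>,
  when \<open>d\<close> is not itself a selector.\<close>

definition pair_partners :: "nat \<Rightarrow> nat set \<Rightarrow> nat set" where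
  "pair_partners d x = {j \<in> x. 7 \<le> j \<and> selector (j + d) \<in> x}"

text \<open>As \<open>d\<close> is no selector, no old pair changes its status and every new pair
  contains \<open>d\<close>. Pairs are ordered decreasingly, so \<open>h\<close> puts a partner on
  whichever side of \<open>d\<close> it belongs.\<close>

lemma form_value_insert:
  assumes x: "finite x" "d \<notin> x" "7 \<le> d" and sel: "\<And>i j. i \<in> insert d x \<Longrightarrow> j \<in> insert d x \<Longrightarrow> selector (i + j) \<noteq> d"
  shows "form_value (insert d x) = form_value x + card (pair_partners d x)"
proof -
  define h where "h j = (max d j, min d j)" for j
  have "inj_on h (pair_partners d x)"
    using x(2) by (auto simp: inj_on_def h_def pair_partners_def max_def min_def split: if_splits)
  then have "card (h ` pair_partners d x) = card (pair_partners d x)"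
    by (rule card_image)
  moreover have "active_pairs (insert d x) = active_pairs x \<union> h ` pair_partners d x"
  proof (intro equalityI subsetI)
    fix q assume q: "q \<in> active_pairs (insert d x)"
    obtain i j where [simp]: "q = (i, j)" by (cases q)
    have ij: "i \<in> insert d x" "j \<in> insert d x" "7 \<le> j" "j < i" "selector (i + j) \<in> x"
      using q sel by (auto simp: active_pairs_def)
    consider "i = d" "j \<in> x" | "j = d" "i \<in> x" | "i \<in> x" "j \<in> x"
      using ij by auto
    then show "q \<in> active_pairs x \<union> h ` pair_partners d x"
    proof cases
      case 1
      then have "j \<in> pair_partners d x" "q = h j"
        using ij by (auto simp: pair_partners_def h_def add.commute)
      then show ?thesis by blast
    next
      case 2
      then have "i \<in> pair_partners d x" "q = h i"
        using ij by (auto simp: pair_partners_def h_def add.commute)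
      then show ?thesis by blast
    next
      case 3
      then show ?thesis using ij by (auto simp: active_pairs_def)
    qed
  next
    fix q assume "q \<in> active_pairs x \<union> h ` pair_partners d x"
    then show "q \<in> active_pairs (insert d x)"
    proof
      assume "q \<in> h ` pair_partners d x"
      then obtain j where j: "j \<in> pair_partners d x" "q = h j" by blast
      then have "j \<noteq> d" using x(2) by (auto simp: pair_partners_def)
      then show ?thesis
        using j x(3) by (cases "j < d") (auto simp: active_pairs_def h_def pair_partners_def add.commute)
    qed (auto simp: active_pairs_def)
  qed
  moreover have "active_pairs x \<inter> h ` pair_partners d x = {}"
    using x(2) by (auto simp: active_pairs_def h_def max_def min_def split: if_splits)
  moreover have "finite (pair_partners d x)"
    using x(1) by (simp add: pair_partners_def)
  ultimately show ?thesis
    using x sel[of d d] by (simp add: form_value_def card_Un_disjoint)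
qed

section \<open>Parity equations over the two-element field\<close>

lemma even_card_Un_Diff:
  assumes "finite a" "finite b"
  shows "even (card a + card b) \<longleftrightarrow> even (card (a - b \<union> (b - a)))"
proof -
  have "card a = card (a - b) + card (a \<inter> b)" "card b = card (b - a) + card (a \<inter> b)"
    using assms by (metis Diff_Int_distrib2 Int_commute add.commute card_Diff_subset_Int card_mono
      finite_Int inf_le1 le_add_diff_inverse2)+
  moreover have "card (a - b \<union> (b - a)) = card (a - b) + card (b - a)"
    using assms by (intro card_Un_disjoint) auto
  ultimately show ?thesis by auto
qed

text \<open>A linear system in echelon form: the pivot \<open>p d\<close> occurs in equation
  \<open>d\<close> and in no earlier one. Toggling it preserves the earlier equations and flips the
  new one, so each equation halves the number of solutions.\<close>

lemma triangular_parity_count: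
  fixes D :: "'d::linorder set" and l :: "'d \<Rightarrow> 'i set"
  assumes "finite Z" "finite D"
    and "\<And>d. d \<in> D \<Longrightarrow> finite (l d) \<and> p d \<in> l d \<and> p d \<in> Z"
    and "\<And>d d'. d \<in> D \<Longrightarrow> d' \<in> D \<Longrightarrow> d' < d \<Longrightarrow> p d \<notin> l d'"
  shows "card {z \<in> Pow Z. \<forall>d\<in>D. even (card (l d \<inter> z))} * 2 ^ card D = 2 ^ card Z"
  using assms(2-)
proof (induction D rule: finite_linorder_max_induct)
  case empty
  then show ?case using \<open>finite Z\<close> by (simp add: card_Pow flip: Pow_def)
next
  case (insert d D)
  define \<Z> where "\<Z> = {z \<in> Pow Z. \<forall>d\<in>D. even (card (l d \<inter> z))}"
  have d: "finite (l d)" "p d \<in> l d" "p d \<in> Z" using insert.prems(1)[of d] by auto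
  have "toggle (p d) z \<in> \<Z> \<and> toggle (p d) (toggle (p d) z) = z \<and>
      (even (card (l d \<inter> toggle (p d) z)) \<longleftrightarrow> odd (card (l d \<inter> z)))" if "z \<in> \<Z>" for z
  proof -
    have "l d' \<inter> toggle (p d) z = l d' \<inter> z" if "d' \<in> D" for d'
      using insert.prems(2)[of d d'] insert.hyps(2) that by (auto simp: toggle_def)
    moreover have "toggle (p d) z \<subseteq> Z"
      using that d(3) by (auto simp: \<Z>_def toggle_def split: if_splits)
    ultimately have "toggle (p d) z \<in> \<Z>" using that by (simp add: \<Z>_def)
    moreover have "even (card (l d \<inter> toggle (p d) z)) \<longleftrightarrow> odd (card (l d \<inter> z))"
    proof (cases "p d \<in> z")
      case True
      then have "l d \<inter> z = insert (p d) (l d \<inter> toggle (p d) z)" "p d \<notin> l d \<inter> toggle (p d) z"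
        using d by (auto simp: toggle_def)
      then show ?thesis using d(1) by simp
    next
      case False
      then have "l d \<inter> toggle (p d) z = insert (p d) (l d \<inter> z)" "p d \<notin> l d \<inter> z"
        using d by (auto simp: toggle_def)
      then show ?thesis using d(1) by simp
    qed
    ultimately show ?thesis by simp
  qed
  then have half: "2 * card {z \<in> \<Z>. even (card (l d \<inter> z))} = card \<Z>"
    using \<open>finite Z\<close> by (intro card_even_toggle[where t = "toggle (p d)"]) (auto simp: \<Z>_def)
  have set_eq: "{z \<in> Pow Z. \<forall>d\<in>insert d D. even (card (l d \<inter> z))} = {z \<in> \<Z>. even (card (l d \<inter> z))}"
    by (auto simp: \<Z>_def)
  have "card (insert d D) = Suc (card D)"
    using insert.hyps by (subst card_insert_disjoint) auto
  then have "card {z \<in> Pow Z. \<forall>d\<in>insert d D. even (card (l d \<inter> z))} * 2 ^ card (insert d D) =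
      2 * card {z \<in> \<Z>. even (card (l d \<inter> z))} * 2 ^ card D"
    by (simp only: set_eq power_Suc mult.commute mult.left_commute mult.assoc)
  also have "\<dots> = 2 ^ card Z"
    unfolding half unfolding \<Z>_def using insert by auto
  finally show ?case .
qed

section \<open>Rectangles of zeros over a fixed pair of index sets\<close>

definition sign :: "nat set \<Rightarrow> int" where
  "sign x = (- 1) ^ form_value x"

text \<open>For a fixed assignment $z$ of the remaining variables, the form is bilinear in the variables
  of $A$ and $D$ up to terms that depend on one side only. Its matrix is the Hankel matrix with
  entries $z_{\mathrm{selector}(a+d)}$, whose kernel has two elements on average.\<close>

locale hankel_block =
  fixes n k :: nat and A D :: "nat set"
  assumes AD: "A \<subseteq> {n div 8 + 8..<n}" "D \<subseteq> {n div 8 + 8..<n}" "A \<inter> D = {}"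
    and card_AD: "card A = k" "card D = k"
    and mod_A: "\<And>a a'. a \<in> A \<Longrightarrow> a' \<in> A \<Longrightarrow> a mod 16 = a' mod 16"
    and mod_D: "\<And>d d'. d \<in> D \<Longrightarrow> d' \<in> D \<Longrightarrow> d mod 16 = d' mod 16"
begin

definition Z :: "nat set" where
  "Z = {..<n} - A - D"

definition kernel :: "nat set \<Rightarrow> nat set set" where
  "kernel z = {g \<in> Pow A. \<forall>d\<in>D. even (card {a \<in> g. selector (a + d) \<in> z})}"

lemma fin: "finite A" "finite D" "finite Z"
  using finite_subset[OF AD(1)] finite_subset[OF AD(2)] by (simp_all add: Z_def)

lemma AD_less: "A \<subseteq> {..<n}" "D \<subseteq> {..<n}" "Z \<subseteq> {..<n}"
  using AD(1,2) by (auto simp: Z_def)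

lemma AD_ge:
  assumes "a \<in> A \<union> D"
  shows "n div 8 + 8 \<le> a" "7 \<le> a"
proof -
  have "a \<in> {n div 8 + 8..<n}" using assms AD(1,2) by blast
  then show "n div 8 + 8 \<le> a" "7 \<le> a" by simp_all
qed

lemma AD_disjnt: "A \<inter> D = {}" "A \<inter> Z = {}" "D \<inter> Z = {}"
  using AD(3) by (auto simp: Z_def)

lemma card_Z: "card Z + 2 * k = n"
proof -
  have "A \<union> D \<subseteq> {..<n}" using AD by auto
  moreover have "card (A \<union> D) = 2 * k"
    using fin AD(3) card_AD by (simp add: card_Un_disjoint)
  moreover have "Z = {..<n} - (A \<union> D)" by (auto simp: Z_def)
  ultimately show ?thesis
    using fin card_mono[of "{..<n}" "A \<union> D"] by (simp add: card_Diff_subset)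
qed

text \<open>Members of \<open>A\<close> and \<open>D\<close> start at the cut below which all
  selectors lie. Hence the entries of the matrix depend on \<open>z\<close> alone.\<close>

lemma selector_notin:
  assumes "i < n" "j < n"
  shows "selector (i + j) \<notin> A \<union> D"
proof
  assume "selector (i + j) \<in> A \<union> D"
  then show False using AD_ge(1) selector_less[OF assms] by fastforce
qed

lemma sign_insert:
  assumes "x \<subseteq> {..<n}" "d \<in> D" "d \<notin> x"
  shows "sign (insert d x) = sign x * (- 1) ^ card (pair_partners d x)"
proof -
  have "d < n" "7 \<le> d" using assms(2) AD_less(2) AD_ge(2) by auto
  moreover have "selector (i + j) \<noteq> d" if "i \<in> insert d x" "j \<in> insert d x" for i j
  proof -
    have "i < n" "j < n" using that assms(1) \<open>d < n\<close> by auto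
    then show ?thesis using selector_notin assms(2) by blast
  qed
  ultimately have "form_value (insert d x) = form_value x + card (pair_partners d x)"
    using assms(3) finite_subset[OF assms(1)] by (intro form_value_insert) auto
  then show ?thesis by (simp add: sign_def power_add)
qed

text \<open>Partners in \<open>v\<close>, in \<open>z\<close> or in both \<open>u\<close> and
  \<open>u'\<close> are counted twice and cancel modulo 2. What remains is row \<open>d\<close> of
  the matrix applied to the symmetric difference of \<open>u\<close> and \<open>u'\<close>.\<close>

lemma even_pair_partners:
  assumes "u \<subseteq> A" "u' \<subseteq> A" "v \<subseteq> D" "z \<subseteq> Z" "d \<in> D" "d \<notin> v"
  shows "even (card (pair_partners d (u \<union> v \<union> z)) + card (pair_partners d (u' \<union> v \<union> z))) \<longleftrightarrow>
    even (card {a \<in> u - u' \<union> (u' - u). selector (a + d) \<in> z})"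
proof -
  have sub: "u \<union> v \<union> z \<subseteq> {..<n}" "u' \<union> v \<union> z \<subseteq> {..<n}" and "d < n"
    using assms(1-5) AD_less by (simp_all add: subset_iff)
  have part: "pair_partners d (w \<union> v \<union> z) = {j \<in> w \<union> v \<union> z. 7 \<le> j \<and> selector (j + d) \<in> z}"
    if "w \<subseteq> A" for w
  proof -
    have "selector (j + d) \<in> w \<union> v \<union> z \<longleftrightarrow> selector (j + d) \<in> z" if "j \<in> w \<union> v \<union> z" for j
    proof -
      have "j < n" using that \<open>w \<subseteq> A\<close> assms(3,4) AD_less by blast
      then have "selector (j + d) \<notin> A \<union> D" using selector_notin \<open>d < n\<close> by blast
      then show ?thesis using \<open>w \<subseteq> A\<close> assms(3) by blast
    qed
    then show ?thesis unfolding pair_partners_def by blast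
  qed
  have "finite (u \<union> v \<union> z)" "finite (u' \<union> v \<union> z)"
    using sub finite_subset by blast+
  then have "even (card (pair_partners d (u \<union> v \<union> z)) + card (pair_partners d (u' \<union> v \<union> z))) \<longleftrightarrow>
     even (card (pair_partners d (u \<union> v \<union> z) - pair_partners d (u' \<union> v \<union> z) \<union>
       (pair_partners d (u' \<union> v \<union> z) - pair_partners d (u \<union> v \<union> z))))"
    by (intro even_card_Un_Diff) (auto simp: pair_partners_def)
  also have "pair_partners d (u \<union> v \<union> z) - pair_partners d (u' \<union> v \<union> z) \<union>
       (pair_partners d (u' \<union> v \<union> z) - pair_partners d (u \<union> v \<union> z)) =
      {a \<in> u - u' \<union> (u' - u). selector (a + d) \<in> z}"
  proof -
    have "7 \<le> a \<and> a \<notin> v \<union> z" if "a \<in> A" for a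
      using that assms(3,4) AD_disjnt AD_ge(2)[of a] by blast
    then have "7 \<le> a \<and> a \<notin> v \<and> a \<notin> z" if "a \<in> u \<or> a \<in> u'" for a
      using that assms(1,2) by blast
    then show ?thesis unfolding part[OF assms(1)] part[OF assms(2)] by blast
  qed
  finally show ?thesis .
qed

text \<open>Outside the kernel some row \<open>d\<close> meets the symmetric difference in odd
  parity; switching \<open>d\<close> in \<open>v\<close> then reverses the sign of the product, and
  the terms cancel in pairs. Inside the kernel each term is at most 1.\<close>

lemma correlation_bound:
  assumes "u \<subseteq> A" "u' \<subseteq> A" "z \<subseteq> Z"
  shows "(\<Sum>v\<in>Pow D. sign (u \<union> v \<union> z) * sign (u' \<union> v \<union> z)) \<le>
    (if u - u' \<union> (u' - u) \<in> kernel z then 2 ^ k else 0)"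
proof (cases "u - u' \<union> (u' - u) \<in> kernel z")
  case True
  have "sign x * sign y \<le> 1" for x y
    unfolding sign_def power_add[symmetric] by (cases "even (form_value x + form_value y)") simp_all
  then have "(\<Sum>v\<in>Pow D. sign (u \<union> v \<union> z) * sign (u' \<union> v \<union> z)) \<le> (\<Sum>v\<in>Pow D. 1)"
    by (intro sum_mono)
  also have "\<dots> = 2 ^ k" using fin(2) card_AD(2) by (simp add: card_Pow)
  finally show ?thesis using True by simp
next
  case False
  then obtain d where d: "d \<in> D" "odd (card {a \<in> u - u' \<union> (u' - u). selector (a + d) \<in> z})"
    using assms by (auto simp: kernel_def)
  define F where "F v = sign (u \<union> v \<union> z) * sign (u' \<union> v \<union> z)" for v
  have neg: "F (insert d v) = - F v" if v: "v \<in> Pow (D - {d})" for v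
  proof -
    have notin: "d \<notin> u \<union> v \<union> z" "d \<notin> u' \<union> v \<union> z"
      using assms v d(1) AD_disjnt by blast+
    have sub: "u \<union> v \<union> z \<subseteq> {..<n}" "u' \<union> v \<union> z \<subseteq> {..<n}"
      using assms v AD_less by blast+
    have "odd (card (pair_partners d (u \<union> v \<union> z)) + card (pair_partners d (u' \<union> v \<union> z)))"
      using even_pair_partners[of u u' v z d] assms v d by auto
    then have "(- 1 :: int) ^ card (pair_partners d (u \<union> v \<union> z)) * (- 1) ^ card (pair_partners d (u' \<union> v \<union> z)) = - 1"
      by (simp flip: power_add)
    then show ?thesis
      using sign_insert[OF sub(1) d(1) notin(1)] sign_insert[OF sub(2) d(1) notin(2)]
      by (simp add: F_def mult.assoc mult.left_commute)
  qed
  have "Pow D = Pow (D - {d}) \<union> insert d ` Pow (D - {d})"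
    using Pow_insert[of d "D - {d}"] d(1) by (simp add: insert_absorb)
  then have "(\<Sum>v\<in>Pow D. F v) = (\<Sum>v\<in>Pow (D - {d}). F v) + (\<Sum>v\<in>insert d ` Pow (D - {d}). F v)"
    using fin(2) by (simp only:) (rule sum.union_disjoint; auto)
  also have "(\<Sum>v\<in>insert d ` Pow (D - {d}). F v) = (\<Sum>v\<in>Pow (D - {d}). F (insert d v))"
    by (rule sum.reindex_cong[where l = "insert d"]) (auto simp: inj_on_def)
  also have "\<dots> = - (\<Sum>v\<in>Pow (D - {d}). F v)"
    using neg by (simp add: sum_negf)
  finally show ?thesis using False by (simp add: F_def)
qed

text \<open>Double counting: each nonempty \<open>g\<close> lies in the kernel for exactly a
  fraction 2^(-k) of all \<open>z\<close>, so these fewer than 2^k sets contribute less than 2^(card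
  Z) together; the empty set contributes 2^(card Z).\<close>

lemma sum_card_kernel: "(\<Sum>z\<in>Pow Z. card (kernel z)) \<le> 2 * 2 ^ card Z"
proof -
  define P where "P g z \<longleftrightarrow> (\<forall>d\<in>D. even (card {a \<in> g. selector (a + d) \<in> z}))" for g z
  have nonempty: "card {z \<in> Pow Z. P g z} * 2 ^ k = 2 ^ card Z" if g: "g \<subseteq> A" "g \<noteq> {}" for g
  proof -
    have fg: "finite g" using g(1) fin(1) finite_subset by blast
    \<comment> \<open>The largest element provides the pivots: \<open>selector (a0 + d)\<close>
      exceeds every selector that an earlier row \<open>d'\<close> produces on
      \<open>g\<close>.\<close>
    define a0 where "a0 = Max g"
    have a0: "a0 \<in> g" "\<And>a. a \<in> g \<Longrightarrow> a \<le> a0" using fg g(2) by (auto simp: a0_def)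
    define l where "l d = (\<lambda>a. selector (a + d)) ` g" for d
    have inj: "inj_on (\<lambda>a. selector (a + d)) g" for d
    proof (rule inj_onI)
      fix a a' assume a: "a \<in> g" "a' \<in> g" "selector (a + d) = selector (a' + d)"
      have "a mod 16 = a' mod 16" using mod_A a g(1) by auto
      then show "a = a'"
        using selector_strict_mono[of a a' d] selector_strict_mono[of a' a d] a(3)
        by (metis less_irrefl linorder_neqE_nat)
    qed
    have "card {a \<in> g. selector (a + d) \<in> z} = card (l d \<inter> z)" for d z
    proof -
      have "l d \<inter> z = (\<lambda>a. selector (a + d)) ` {a \<in> g. selector (a + d) \<in> z}"
        by (auto simp: l_def)
      then show ?thesis
        using inj[of d] by (simp add: card_image inj_on_subset)
    qed
    then have "{z \<in> Pow Z. P g z} = {z \<in> Pow Z. \<forall>d\<in>D. even (card (l d \<inter> z))}"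
      by (simp add: P_def)
    moreover have "card {z \<in> Pow Z. \<forall>d\<in>D. even (card (l d \<inter> z))} * 2 ^ card D = 2 ^ card Z"
    proof (rule triangular_parity_count[where p = "\<lambda>d. selector (a0 + d)"])
      fix d assume "d \<in> D"
      then have "a0 < n" "d < n" "n div 8 + 8 \<le> d" using a0(1) g(1) AD_less AD_ge(1) by auto
      then have "selector (a0 + d) \<in> Z"
        using selector_less[of a0 n d] selector_notin[of a0 d] by (simp add: Z_def)
      then show "finite (l d) \<and> selector (a0 + d) \<in> l d \<and> selector (a0 + d) \<in> Z"
        using fg a0(1) by (auto simp: l_def)
    next
      fix d d' assume d: "d \<in> D" "d' \<in> D" "d' < d"
      have "selector (a + d') < selector (a0 + d)" if "a \<in> g" for a
      proof -
        have "selector (a + d') \<le> selector (a0 + d')"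
          using a0(2)[OF that] by (intro selector_mono) simp
        also have "\<dots> < selector (a0 + d)"
          using selector_strict_mono[OF d(3), of a0] mod_D[OF d(2,1)] by (simp add: add.commute)
        finally show ?thesis .
      qed
      then show "selector (a0 + d) \<notin> l d'" by (fastforce simp: l_def)
    qed (use fin in auto)
    ultimately show ?thesis using card_AD(2) by simp
  qed
  have "(\<Sum>z\<in>Pow Z. card (kernel z)) = (\<Sum>z\<in>Pow Z. \<Sum>g\<in>Pow A. if P g z then 1 else 0)"
    using fin(1) by (intro sum.cong refl) (simp add: kernel_def P_def sum.If_cases Int_def)
  also have "\<dots> = (\<Sum>g\<in>Pow A. \<Sum>z\<in>Pow Z. if P g z then 1 else 0)"
    by (rule sum.swap)
  also have "\<dots> = (\<Sum>g\<in>Pow A. card {z \<in> Pow Z. P g z})"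
    using fin(3) by (intro sum.cong refl) (simp add: sum.If_cases Int_def)
  finally have sum: "(\<Sum>z\<in>Pow Z. card (kernel z)) = (\<Sum>g\<in>Pow A. card {z \<in> Pow Z. P g z})" .
  have "2 ^ k * (\<Sum>g\<in>Pow A. card {z \<in> Pow Z. P g z}) =
      2 ^ k * card {z \<in> Pow Z. P {} z} + (\<Sum>g\<in>Pow A - {{}}. card {z \<in> Pow Z. P g z} * 2 ^ k)"
    using fin(1) by (subst sum.remove[of _ "{}"]) (auto simp: distrib_left sum_distrib_left mult.commute)
  also have "\<dots> = 2 ^ k * 2 ^ card Z + (\<Sum>g\<in>Pow A - {{}}. 2 ^ card Z)"
    using nonempty fin(3) by (intro arg_cong2[where f = "(+)"] sum.cong) (auto simp: P_def card_Pow simp flip: Pow_def)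
  also have "(\<Sum>g\<in>Pow A - {{}}. 2 ^ card Z) \<le> (\<Sum>g\<in>Pow A. (2::nat) ^ card Z)"
    using fin(1) by (intro sum_mono2) auto
  also have "(\<Sum>g\<in>Pow A. (2::nat) ^ card Z) = 2 ^ k * 2 ^ card Z"
    using fin(1) card_AD(1) by (simp add: card_Pow)
  finally have "2 ^ k * (\<Sum>g\<in>Pow A. card {z \<in> Pow Z. P g z}) \<le> 2 ^ k * (2 * 2 ^ card Z)"
    by (simp only: mult_2 distrib_left)
  then show ?thesis unfolding sum by (rule mult_left_le_imp_le) simp
qed

text \<open>The second-moment argument of Lindsey's lemma. All signs on the rectangle are 1, so the
  squared sums over \<open>U\<close> add up to |V| |U|^2 on \<open>V\<close>. Extending to all
  subsets of \<open>D\<close> and expanding the square leaves the correlations, at most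
  \<open>card (kernel z)\<close> of which have a nonzero bound for each \<open>u\<close>.\<close>

lemma card_rectangle_le:
  assumes z: "z \<subseteq> Z" and U: "U \<subseteq> Pow A" and V: "V \<subseteq> Pow D"
    and hard: "\<And>u v. u \<in> U \<Longrightarrow> v \<in> V \<Longrightarrow> u \<union> v \<union> z \<in> hard_family n"
  shows "card U * card V \<le> 2 ^ k * card (kernel z)"
proof (cases "U = {}")
  case False
  have fUV: "finite U" "finite V" using U V fin finite_subset by (metis finite_Pow_iff)+
  have fker: "finite (kernel z)" using fin(1) by (simp add: kernel_def)
  have "(\<Sum>u\<in>U. sign (u \<union> v \<union> z)) = card U" if "v \<in> V" for v
  proof -
    have "sign (u \<union> v \<union> z) = 1" if "u \<in> U" for u
      using hard[OF that \<open>v \<in> V\<close>] by (simp add: hard_family_def sign_def)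
    then show ?thesis by simp
  qed
  then have "int (card V) * (int (card U))\<^sup>2 = (\<Sum>v\<in>V. (\<Sum>u\<in>U. sign (u \<union> v \<union> z))\<^sup>2)"
    by simp
  also have "\<dots> \<le> (\<Sum>v\<in>Pow D. (\<Sum>u\<in>U. sign (u \<union> v \<union> z))\<^sup>2)"
    using V fin(2) by (intro sum_mono2) auto
  also have "\<dots> = (\<Sum>v\<in>Pow D. \<Sum>u\<in>U. \<Sum>u'\<in>U. sign (u \<union> v \<union> z) * sign (u' \<union> v \<union> z))"
    by (simp add: power2_eq_square sum_product)
  also have "\<dots> = (\<Sum>u\<in>U. \<Sum>v\<in>Pow D. \<Sum>u'\<in>U. sign (u \<union> v \<union> z) * sign (u' \<union> v \<union> z))"
    by (rule sum.swap)
  also have "\<dots> = (\<Sum>u\<in>U. \<Sum>u'\<in>U. \<Sum>v\<in>Pow D. sign (u \<union> v \<union> z) * sign (u' \<union> v \<union> z))"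
    by (intro sum.cong refl sum.swap)
  also have "\<dots> \<le> (\<Sum>u\<in>U. \<Sum>u'\<in>U. if u - u' \<union> (u' - u) \<in> kernel z then 2 ^ k else 0)"
    using U z by (intro sum_mono correlation_bound) auto
  also have "\<dots> \<le> (\<Sum>u\<in>U. 2 ^ k * int (card (kernel z)))"
  proof (rule sum_mono)
    fix u assume "u \<in> U"
    have "inj_on (\<lambda>u'. u - u' \<union> (u' - u)) {u' \<in> U. u - u' \<union> (u' - u) \<in> kernel z}"
      by (rule inj_onI) blast
    then have "card {u' \<in> U. u - u' \<union> (u' - u) \<in> kernel z} \<le> card (kernel z)"
      by (rule card_inj_on_le) (use fker in auto)
    moreover have "(\<Sum>u'\<in>U. if u - u' \<union> (u' - u) \<in> kernel z then 2 ^ k else 0) =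
        int (card {u' \<in> U. u - u' \<union> (u' - u) \<in> kernel z}) * 2 ^ k"
      using fUV(1) by (simp add: sum.If_cases Int_def)
    ultimately show "(\<Sum>u'\<in>U. if u - u' \<union> (u' - u) \<in> kernel z then 2 ^ k else 0) \<le>
        2 ^ k * int (card (kernel z))" by (simp add: mult.commute)
  qed
  also have "\<dots> = int (card U) * (2 ^ k * int (card (kernel z)))"
    by simp
  finally have "int (card U) * (int (card U) * int (card V)) \<le> int (card U) * (2 ^ k * int (card (kernel z)))"
    by (simp add: power2_eq_square mult.commute mult.left_commute)
  moreover have "0 < int (card U)" using False fUV(1) by (simp add: card_gt_0_iff)
  ultimately have "int (card U) * int (card V) \<le> 2 ^ k * int (card (kernel z))"
    by (simp add: mult_le_cancel_left_pos)
  then have "int (card U * card V) \<le> int (2 ^ k * card (kernel z))" by simp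
  then show ?thesis by linarith
qed simp

text \<open>The members with the same trace \<open>z\<close> outside \<open>A\<close> and
  \<open>D\<close> embed into a rectangle of zeros. Summing over \<open>z\<close> with the average
  kernel size gives 2 * 2^(k + card Z), where card Z = n - 2k.\<close>

lemma card_mixable_le:
  assumes W: "W \<subseteq> hard_family n"
    and mix: "\<And>x x'. x \<in> W \<Longrightarrow> x' \<in> W \<Longrightarrow> x - (A \<union> D) = x' - (A \<union> D) \<Longrightarrow> mix A x x' \<in> W"
  shows "card W * 2 ^ k \<le> 2 * 2 ^ n"
proof -
  have sub: "x \<subseteq> {..<n}" if "x \<in> W" for x using W that by (auto simp: hard_family_def)
  have fW: "finite W" using sub by (intro finite_subset[of W "Pow {..<n}"]) auto
  define Wz where "Wz z = {x \<in> W. x - (A \<union> D) = z}" for z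
  have Wz: "card (Wz z) \<le> 2 ^ k * card (kernel z)" if "z \<subseteq> Z" for z
  proof -
    define U where "U = (\<lambda>x. x \<inter> A) ` Wz z"
    define V where "V = (\<lambda>x. x \<inter> D) ` Wz z"
    have fUV: "finite U" "finite V" using fW by (auto simp: U_def V_def Wz_def)
    have "card (Wz z) \<le> card (U \<times> V)"
    proof (rule card_inj_on_le[where f = "\<lambda>x. (x \<inter> A, x \<inter> D)"])
      show "inj_on (\<lambda>x. (x \<inter> A, x \<inter> D)) (Wz z)"
        by (rule inj_onI) (auto simp: Wz_def)
    qed (use fUV in \<open>auto simp: U_def V_def\<close>)
    also have "\<dots> = card U * card V" by (rule card_cartesian_product)
    also have "\<dots> \<le> 2 ^ k * card (kernel z)"
    proof (rule card_rectangle_le[OF that])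
      fix u v assume "u \<in> U" "v \<in> V"
      then obtain x x' where x: "x \<in> Wz z" "x' \<in> Wz z" "u = x \<inter> A" "v = x' \<inter> D"
        by (auto simp: U_def V_def)
      have "mix A x x' = u \<union> v \<union> z"
        using x AD(3) by (auto simp: mix_def Wz_def)
      moreover have "mix A x x' \<in> W" using x mix by (simp add: Wz_def)
      ultimately show "u \<union> v \<union> z \<in> hard_family n" using W by auto
    qed (auto simp: U_def V_def)
    finally show ?thesis .
  qed
  have "W = (\<Union>z\<in>Pow Z. Wz z)"
  proof (intro equalityI subsetI)
    fix x assume "x \<in> W"
    then have "x - (A \<union> D) \<in> Pow Z" "x \<in> Wz (x - (A \<union> D))"
      using sub[OF \<open>x \<in> W\<close>] unfolding Z_def Wz_def by blast+
    then show "x \<in> (\<Union>z\<in>Pow Z. Wz z)" by (rule UN_I)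
  qed (simp add: Wz_def)
  then have "card W \<le> (\<Sum>z\<in>Pow Z. card (Wz z))"
    using card_UN_le[of "Pow Z" Wz] fin(3) by simp
  also have "\<dots> \<le> (\<Sum>z\<in>Pow Z. 2 ^ k * card (kernel z))"
    using Wz by (intro sum_mono) auto
  also have "\<dots> = 2 ^ k * (\<Sum>z\<in>Pow Z. card (kernel z))"
    by (simp add: sum_distrib_left)
  also have "\<dots> \<le> 2 ^ k * (2 * 2 ^ card Z)"
    using sum_card_kernel by simp
  finally have "card W * 2 ^ k \<le> 2 ^ k * (2 * 2 ^ card Z) * 2 ^ k"
    by (rule mult_le_mono1)
  also have "\<dots> = 2 * 2 ^ (k + card Z + k)"
    by (simp only: power_add ac_simps)
  also have "k + card Z + k = n" using card_Z by simp
  finally show ?thesis .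
qed

end

section \<open>From large blocks to residue classes, and counting covers\<close>

lemma residue_class_subset:
  assumes B: "finite B" "16 * k \<le> card B"
  shows "\<exists>B'\<subseteq>B. card B' = k \<and> (\<forall>b\<in>B'. \<forall>b'\<in>B'. b mod 16 = b' mod (16::nat))"
proof -
  have "\<exists>r<16. k \<le> card {b \<in> B. b mod 16 = r}"
  proof (rule ccontr)
    assume "\<not> ?thesis"
    then have less: "card {b \<in> B. b mod 16 = r} < k" if "r < 16" for r using that by (meson not_le)
    have "B = (\<Union>r<16. {b \<in> B. b mod 16 = r})" by auto
    then have "card B \<le> (\<Sum>r<16. card {b \<in> B. b mod 16 = r})"
      using card_UN_le[of "{..<16}" "\<lambda>r. {b \<in> B. b mod 16 = r}"] by simp
    also have "\<dots> < (\<Sum>r<(16::nat). k)"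
      using less by (intro sum_strict_mono) (auto simp: lessThan_empty_iff)
    finally show False using B(2) by simp
  qed
  then obtain r B' where "B' \<subseteq> {b \<in> B. b mod 16 = r}" "card B' = k"
    by (meson obtain_subset_with_card_n)
  then show ?thesis by (intro exI[of _ B']) auto
qed

text \<open>Removing the indices below the selector cut leaves at least n/6 - (n div 8 + 8) \<ge>
  16k elements, and the most frequent residue keeps k of them.\<close>

lemma large_subset_residue_class:
  assumes B: "B \<subseteq> {..<n}" "n \<le> 6 * card B" and k: "6 * (16 * k + (n div 8 + 8)) \<le> n"
  shows "\<exists>B'\<subseteq>B. B' \<subseteq> {n div 8 + 8..<n} \<and> card B' = k \<and>
    (\<forall>b\<in>B'. \<forall>b'\<in>B'. b mod 16 = b' mod 16)"
proof -
  define L where "L = n div 8 + 8"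
  have fB: "finite B" using B(1) finite_subset by blast
  have "card B \<le> card (B - {..<L}) + card {..<L}"
    using card_mono[of "(B - {..<L}) \<union> {..<L}" B] card_Un_le[of "B - {..<L}" "{..<L}"] fB by fastforce
  then have "16 * k \<le> card (B - {..<L})"
    using B(2) k by (simp add: L_def)
  then obtain B' where "B' \<subseteq> B - {..<L}" "card B' = k" "\<forall>b\<in>B'. \<forall>b'\<in>B'. b mod 16 = b' mod 16"
    using residue_class_subset[of "B - {..<L}" k] fB by auto
  moreover from this have "B' \<subseteq> {L..<n}" using B(1) by (auto simp: subset_iff)
  ultimately show ?thesis unfolding L_def[symmetric] by blast
qed

text \<open>Members that agree outside the smaller sets agree on the dropped indices as well, so the
  exchange on \<open>A'\<close> coincides with the exchange on \<open>A\<close>.\<close>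

lemma card_mixable_large_le:
  assumes W: "W \<subseteq> hard_family n"
    and A: "A \<subseteq> {..<n}" "D \<subseteq> {..<n}" "A \<inter> D = {}" "n \<le> 6 * card A" "n \<le> 6 * card D"
    and k: "6 * (16 * k + (n div 8 + 8)) \<le> n"
    and mix: "\<And>x x'. x \<in> W \<Longrightarrow> x' \<in> W \<Longrightarrow> x - (A \<union> D) = x' - (A \<union> D) \<Longrightarrow> mix A x x' \<in> W"
  shows "card W * 2 ^ k \<le> 2 * 2 ^ n"
proof -
  obtain A' where A': "A' \<subseteq> A" "A' \<subseteq> {n div 8 + 8..<n}" "card A' = k"
      "\<forall>b\<in>A'. \<forall>b'\<in>A'. b mod 16 = b' mod 16"
    using large_subset_residue_class[OF A(1,4) k] by blast
  obtain D' where D': "D' \<subseteq> D" "D' \<subseteq> {n div 8 + 8..<n}" "card D' = k"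
      "\<forall>b\<in>D'. \<forall>b'\<in>D'. b mod 16 = b' mod 16"
    using large_subset_residue_class[OF A(2,5) k] by blast
  interpret hankel_block n k A' D'
  proof
    show "A' \<inter> D' = {}" using A'(1) D'(1) A(3) by blast
    show "a mod 16 = a' mod 16" if "a \<in> A'" "a' \<in> A'" for a a' using A'(4) that by blast
    show "d mod 16 = d' mod 16" if "d \<in> D'" "d' \<in> D'" for d d' using D'(4) that by blast
  qed (use A' D' in auto)
  show ?thesis
  proof (rule card_mixable_le[OF W])
    fix x x' assume x: "x \<in> W" "x' \<in> W" "x - (A' \<union> D') = x' - (A' \<union> D')"
    have "x - (A \<union> D) = x' - (A \<union> D)" using x(3) A'(1) D'(1) by blast
    then have "mix A x x' \<in> W" using mix x(1,2) by blast
    moreover have "mix A x x' = mix A' x x'"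
      using x(3) A'(1) D'(1) A(3) unfolding mix_def by blast
    ultimately show "mix A' x x' \<in> W" by simp
  qed
qed

text \<open>The two partitions cut the variables into four blocks. Each rectangle of the first kind meets
  a rectangle of the second kind in a set that splits freely between the two blocks of either
  diagonal, once the other two blocks are fixed; one diagonal consists of two large blocks.\<close>

lemma card_mix_closed_Int_le:
  assumes R: "R1 \<inter> R2 \<subseteq> hard_family n" "mix_closed Y1 R1" "mix_closed Y2 R2"
    and Y: "balanced n Y1" "balanced n Y2" and k: "6 * (16 * k + (n div 8 + 8)) \<le> n"
  shows "card (R1 \<inter> R2) * 2 ^ k \<le> 2 * 2 ^ n"
proof -
  define A where "A = Y1 \<inter> Y2"
  define B where "B = Y1 - Y2"
  define C where "C = Y2 - Y1"
  define D where "D = {..<n} - Y1 - Y2"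
  have sub: "Y1 \<subseteq> {..<n}" "Y2 \<subseteq> {..<n}" using Y by (auto simp: balanced_def)
  have fin: "finite A" "finite B" "finite C" "finite D" "finite Y1" "finite Y2"
    using sub finite_subset[OF _ finite_lessThan] by (auto simp: A_def B_def C_def D_def)
  have Rn: "x \<subseteq> {..<n}" if "x \<in> R1 \<inter> R2" for x
    using R(1) that by (auto simp: hard_family_def)
  have "card Y1 = card A + card B"
    using fin by (subst card_Un_disjoint[symmetric]) (auto simp: A_def B_def intro!: arg_cong[where f = card])
  moreover have "card Y2 = card A + card C"
    using fin by (subst card_Un_disjoint[symmetric]) (auto simp: A_def C_def intro!: arg_cong[where f = card])
  moreover have "n = card Y1 + card C + card D"
  proof -
    have "{..<n} = Y1 \<union> C \<union> D" using sub by (auto simp: C_def D_def)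
    then have "n = card (Y1 \<union> C \<union> D)" by (metis card_lessThan)
    also have "\<dots> = card (Y1 \<union> C) + card D"
      using fin by (intro card_Un_disjoint) (auto simp: C_def D_def)
    also have "card (Y1 \<union> C) = card Y1 + card C"
      using fin by (intro card_Un_disjoint) (auto simp: C_def)
    finally show ?thesis .
  qed
  \<comment> \<open>\<open>Y1\<close>, \<open>Y2\<close> and their complements have at least n/3
    elements each. If \<open>A\<close> or \<open>D\<close> has fewer than n/6, then both
    \<open>B\<close> and \<open>C\<close> must make up the difference.\<close>
  ultimately consider "n \<le> 6 * card A" "n \<le> 6 * card D" | "n \<le> 6 * card B" "n \<le> 6 * card C"
    using Y unfolding balanced_def by linarith
  then show ?thesis
  proof cases
    case 1
    show ?thesis
    proof (rule card_mixable_large_le[OF R(1) _ _ _ 1 k])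
      fix x x' assume x: "x \<in> R1 \<inter> R2" "x' \<in> R1 \<inter> R2" "x - (A \<union> D) = x' - (A \<union> D)"
      have "mix A x x' = mix Y1 x x'" "mix A x x' = mix Y2 x x'"
        using x(3) Rn[OF x(1)] Rn[OF x(2)] unfolding mix_def A_def D_def by blast+
      then show "mix A x x' \<in> R1 \<inter> R2"
        using R(2,3) x(1,2) unfolding mix_closed_def by (metis IntD1 IntD2 IntI)
    qed (use sub in \<open>auto simp: A_def D_def\<close>)
  next
    case 2
    show ?thesis
    proof (rule card_mixable_large_le[OF R(1) _ _ _ 2 k])
      fix x x' assume x: "x \<in> R1 \<inter> R2" "x' \<in> R1 \<inter> R2" "x - (B \<union> C) = x' - (B \<union> C)"
      \<comment> \<open>\<open>B\<close> lies inside \<open>Y1\<close> but outside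
        \<open>Y2\<close>, so for \<open>Y2\<close> the two arguments trade places.\<close>
      have "mix B x x' = mix Y1 x x'" "mix B x x' = mix Y2 x' x"
        using x(3) unfolding mix_def B_def C_def by blast+
      then show "mix B x x' \<in> R1 \<inter> R2"
        using R(2,3) x(1,2) unfolding mix_closed_def by (metis IntD1 IntD2 IntI)
    qed (use sub in \<open>auto simp: B_def C_def\<close>)
  qed
qed

text \<open>The intersections cover all 2^(n-1) zeros, and each of them contains at most
  2^(n+1-k).\<close>

lemma hard_family_cover_bound:
  assumes n: "3 \<le> n" and k: "6 * (16 * k + (n div 8 + 8)) \<le> n"
    and fin: "finite \<R>1" "finite \<R>2"
    and \<R>1: "\<And>R. R \<in> \<R>1 \<Longrightarrow> \<exists>Y. balanced n Y \<and> mix_closed Y R"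
    and \<R>2: "\<And>R. R \<in> \<R>2 \<Longrightarrow> \<exists>Y. balanced n Y \<and> mix_closed Y R"
    and cover: "\<Union>\<R>1 \<inter> \<Union>\<R>2 = hard_family n"
  shows "2 ^ k \<le> 4 * (card \<R>1 * card \<R>2)"
proof -
  have le: "card (R1 \<inter> R2) * 2 ^ k \<le> 2 * 2 ^ n" if "R1 \<in> \<R>1" "R2 \<in> \<R>2" for R1 R2
  proof -
    obtain Y1 Y2 where Y: "balanced n Y1" "mix_closed Y1 R1" "balanced n Y2" "mix_closed Y2 R2"
      using \<R>1[OF \<open>R1 \<in> \<R>1\<close>] \<R>2[OF \<open>R2 \<in> \<R>2\<close>] by blast
    moreover have "R1 \<inter> R2 \<subseteq> hard_family n" using cover that by blast
    ultimately show ?thesis using card_mix_closed_Int_le k by blast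
  qed
  have "hard_family n = (\<Union>(R1, R2)\<in>\<R>1 \<times> \<R>2. R1 \<inter> R2)"
    using cover by auto
  then have "card (hard_family n) \<le> (\<Sum>(R1, R2)\<in>\<R>1 \<times> \<R>2. card (R1 \<inter> R2))"
    using card_UN_le[of "\<R>1 \<times> \<R>2" "\<lambda>(R1, R2). R1 \<inter> R2"] fin by (simp add: case_prod_beta)
  then have "2 * card (hard_family n) * 2 ^ k \<le> 2 * (\<Sum>(R1, R2)\<in>\<R>1 \<times> \<R>2. card (R1 \<inter> R2)) * 2 ^ k"
    by simp
  also have "\<dots> = 2 * (\<Sum>(R1, R2)\<in>\<R>1 \<times> \<R>2. card (R1 \<inter> R2) * 2 ^ k)"
    by (simp add: sum_distrib_right case_prod_beta mult.assoc)
  also have "\<dots> \<le> 2 * (\<Sum>(R1, R2)\<in>\<R>1 \<times> \<R>2. 2 * 2 ^ n)"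
    using le by (intro mult_le_mono2 sum_mono) auto
  also have "\<dots> = 2 ^ n * (4 * (card \<R>1 * card \<R>2))"
    by (simp add: card_cartesian_product case_prod_beta)
  finally have "2 ^ n * 2 ^ k \<le> 2 ^ n * (4 * (card \<R>1 * card \<R>2))"
    using card_hard_family[OF n] by simp
  then show ?thesis by (rule mult_left_le_imp_le) simp
qed

section \<open>The 0-1 polynomial with the hard support\<close>

lemma keys_multilinear_inject:
  fixes m m' :: monomial
  assumes "\<forall>i. Poly_Mapping.lookup m i \<le> 1" "\<forall>i. Poly_Mapping.lookup m' i \<le> 1"
    and "Poly_Mapping.keys m = Poly_Mapping.keys m'"
  shows "m = m'"
proof (rule poly_mapping_eqI)
  fix i
  have "Poly_Mapping.lookup m i = 0 \<longleftrightarrow> Poly_Mapping.lookup m' i = 0"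
    using assms(3) by (metis in_keys_iff)
  moreover have "Poly_Mapping.lookup m i \<le> 1" "Poly_Mapping.lookup m' i \<le> 1"
    using assms(1,2) by auto
  ultimately show "Poly_Mapping.lookup m i = Poly_Mapping.lookup m' i" by linarith
qed

lift_definition hard_poly :: "nat \<Rightarrow> rat mpoly"
  is "\<lambda>n m. if (\<forall>i. Poly_Mapping.lookup m i \<le> 1) \<and> Poly_Mapping.keys m \<in> hard_family n then 1 else 0"
proof -
  fix n
  have "finite (hard_family n)"
    by (rule finite_subset[of _ "Pow {..<n}"]) (auto simp: hard_family_def)
  moreover have "inj_on Poly_Mapping.keys {m :: monomial. \<forall>i. Poly_Mapping.lookup m i \<le> 1}"
    by (rule inj_onI) (simp add: keys_multilinear_inject)
  ultimately have "finite (Poly_Mapping.keys -` hard_family n \<inter> {m :: monomial. \<forall>i. Poly_Mapping.lookup m i \<le> 1})"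
    by (rule finite_vimage_IntI)
  then show "finite {m :: monomial. (if (\<forall>i. Poly_Mapping.lookup m i \<le> 1) \<and>
      Poly_Mapping.keys m \<in> hard_family n then 1 else 0) \<noteq> (0 :: rat)}"
    by (rule rev_finite_subset) auto
qed

lemma lookup_hard_poly:
  "Poly_Mapping.lookup (hard_poly n) m =
    (if (\<forall>i. Poly_Mapping.lookup m i \<le> 1) \<and> Poly_Mapping.keys m \<in> hard_family n then 1 else 0)"
  by (simp add: hard_poly.rep_eq)

section \<open>A machine for the coefficients\<close>

definition runs :: "instr list \<Rightarrow> ram_config \<Rightarrow> nat \<Rightarrow> ram_config \<Rightarrow> bool" where
  "runs P s T s' \<longleftrightarrow> (\<exists>t\<le>T. (ram_step P ^^ t) s = s')"

lemma runs_refl: "runs P s T s"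
  unfolding runs_def by (intro exI[of _ 0]) simp

text \<open>Applied backwards, this rule executes the program symbolically, one instruction per
  \<open>Suc\<close> of the time bound; hence the step counts written as towers of
  \<open>Suc\<close>.\<close>

lemma runs_step:
  assumes "fst s < length P" "runs P (exec_instr (P ! fst s) s) T s'"
  shows "runs P s (Suc T) s'"
proof -
  obtain t where "t \<le> T" "(ram_step P ^^ t) (exec_instr (P ! fst s) s) = s'"
    using assms(2) by (auto simp: runs_def)
  then show ?thesis
    using assms(1) unfolding runs_def
    by (intro exI[of _ "Suc t"]) (simp add: funpow_Suc_right ram_step_def del: funpow.simps)
qed

lemma runs_trans:
  assumes "runs P s T s'" "runs P s' T' s''"
  shows "runs P s (T + T') s''"
proof -
  obtain t t' where "t \<le> T" "(ram_step P ^^ t) s = s'" "t' \<le> T'" "(ram_step P ^^ t') s' = s''"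
    using assms by (auto simp: runs_def)
  then show ?thesis
    unfolding runs_def by (intro exI[of _ "t' + t"]) (simp add: funpow_add)
qed

lemma runs_mono: "runs P s T s' \<Longrightarrow> T \<le> T' \<Longrightarrow> runs P s T' s'"
  unfolding runs_def using le_trans by blast

text \<open>The first block makes room for the working registers by moving the exponents in the
  registers 1 to 7 to the addresses $32n, \ldots, 32n+6$; register 3 keeps its exponent and becomes
  the parity accumulator. The outer loop (24--52) runs an address down from $32n+6$ to 8 in
  register 0, the inner loop (31--48) runs a smaller one down in register 4. All loops range over
  the unused addresses between $n$ and $32n$ as well, which hold 0. The rejecting exit is 55.\<close>

definition prog :: "instr list" where
  "prog = [
    JumpPos 0 4, Set 0 1, Set 1 1, JumpPos 1 56,
    Add 0 0 0, Add 0 0 0, Add 0 0 0, Add 0 0 0, Add 0 0 0,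
    Store 0 1, Set 1 1,
    Add 0 0 1, Store 0 2, Add 0 0 1, Store 0 3, Add 0 0 1, Store 0 4,
    Add 0 0 1, Store 0 5, Add 0 0 1, Store 0 6, Add 0 0 1, Store 0 7,
    Set 2 16,
    Load 7 0, Sub 7 7 1, JumpPos 7 55, Add 7 7 1, JumpPos 7 30, JumpPos 1 49,
    Sub 4 0 1,
    Set 5 7, Sub 5 4 5, JumpPos 5 35, JumpPos 1 49,
    Load 7 4, JumpPos 7 38, JumpPos 1 47,
    Add 5 0 4, Set 6 7,
    Add 6 6 1, Sub 5 5 2, JumpPos 5 40,
    Load 7 6, JumpPos 7 46, JumpPos 1 47,
    Sub 3 1 3,
    Sub 4 4 1, JumpPos 1 31,
    Sub 0 0 1, Set 7 7, Sub 7 0 7, JumpPos 7 24,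
    Sub 0 1 3, JumpPos 1 56,
    Set 0 0]"

lemma length_prog [simp]: "length prog = 56"
  by (simp add: prog_def)

section \<open>Invariants of the loops\<close>

definition selector_addr :: "nat \<Rightarrow> nat" where
  "selector_addr w = 7 + (w + 15) div 16"

text \<open>The loop increments before it tests, so it rounds the quotient up. Each round takes
  three steps and removes 16, so \<open>3 * w\<close> is a generous bound.\<close>

lemma runs_divide:
  assumes "0 < w" "r 1 = 1" "r 2 = 16" "r 5 = int w"
  shows "\<exists>c. runs prog (40, r) (3 * w) (43, r(5 := c, 6 := r 6 + int ((w + 15) div 16)))"
  using assms
proof (induction w arbitrary: r rule: less_induct)
  case (less w)
  define r' where "r' = r(5 := int w - 16, 6 := r 6 + 1)"
  show ?case
  proof (cases "w \<le> 16")
    case True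
    have "runs prog (40, r) (Suc (Suc (Suc 0))) (43, r')"
      using less.prems True
      by (intro runs_step) (simp_all add: prog_def r'_def fun_upd_twist runs_refl)
    then have "runs prog (40, r) (3 * w) (43, r')"
      by (rule runs_mono) (use less.prems(1) in simp)
    moreover have "(w + 15) div 16 = 1"
      using True less.prems(1) by (intro div_nat_eqI) auto
    then have "r' = r(5 := int w - 16, 6 := r 6 + int ((w + 15) div 16))"
      by (simp add: r'_def)
    ultimately show ?thesis by metis
  next
    case False
    then obtain v where v: "w = v + 16" "0 < v" using that[of "w - 16"] by simp
    have "runs prog (40, r) (Suc (Suc (Suc 0))) (40, r')"
      using less.prems False
      by (intro runs_step) (simp_all add: prog_def r'_def fun_upd_twist runs_refl)
    moreover have "v < w" "r' 1 = 1" "r' 2 = 16" "r' 5 = int v"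
      using v less.prems by (simp_all add: r'_def)
    then obtain c where "runs prog (40, r') (3 * v) (43, r'(5 := c, 6 := r' 6 + int ((v + 15) div 16)))"
      using less.IH v(2) by blast
    ultimately have "runs prog (40, r) (Suc (Suc (Suc 0)) + 3 * v)
        (43, r'(5 := c, 6 := r' 6 + int ((v + 15) div 16)))"
      by (rule runs_trans)
    then have "runs prog (40, r) (3 * w) (43, r'(5 := c, 6 := r' 6 + int ((v + 15) div 16)))"
      by (rule runs_mono) (use v in simp)
    moreover have "r'(5 := c, 6 := r' 6 + int ((v + 15) div 16)) = r(5 := c, 6 := r 6 + int ((w + 15) div 16))"
      using div_add_self2[of 16 "v + 15"] by (simp add: r'_def v(1) fun_upd_twist ac_simps)
    ultimately show ?thesis by metis
  qed
qed

text \<open>Only the memory beyond the working registers 0 to 7 is read as data.\<close>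

locale prog_data =
  fixes y :: "nat \<Rightarrow> int"
begin

definition ready :: "(nat \<Rightarrow> int) \<Rightarrow> bool" where
  "ready r \<longleftrightarrow> r 1 = 1 \<and> r 2 = 16 \<and> (\<forall>a>7. r a = y a)"

text \<open>\<open>row p j\<close> is what the inner loop counts from address \<open>j\<close>
  downwards, \<open>rows p\<close> what the outer loop counts from \<open>p\<close> downwards.
  Address 8 belongs to index 7.\<close>

definition row :: "nat \<Rightarrow> nat \<Rightarrow> nat set" where
  "row p j = {q \<in> {8..j}. 0 < y q \<and> 0 < y (selector_addr (p + q))}"

definition rows :: "nat \<Rightarrow> (nat \<times> nat) set" where
  "rows p = (SIGMA q:{q \<in> {8..p}. 0 < y q}. row q (q - 1))"

text \<open>Parity is kept in one register, toggled by subtraction from 1.\<close>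

definition flip_if_odd :: "nat \<Rightarrow> int \<Rightarrow> int" where
  "flip_if_odd k a = (if even k then a else 1 - a)"

lemma finite_row [simp]: "finite (row p j)"
  by (simp add: row_def)

lemma flip_if_odd_add: "flip_if_odd k (flip_if_odd l a) = flip_if_odd (k + l) a"
  by (simp add: flip_if_odd_def)

text \<open>The division takes at most 3 * (p + j) \<le> 6 * p steps; the 20 covers the
  straight-line code around it.\<close>

lemma runs_inner_body:
  assumes "ready r" "r 0 = int p" "r 4 = int j" "7 < j" "j < p"
  shows "\<exists>r'. runs prog (31, r) (6 * p + 20) (31, r') \<and> ready r' \<and> r' 0 = int p \<and>
    r' 4 = int (j - 1) \<and>
    r' 3 = flip_if_odd (if 0 < y j \<and> 0 < y (selector_addr (p + j)) then 1 else 0) (r 3)"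
proof -
  have r: "r 1 = 1" "r 2 = 16" "r j = y j" "r (selector_addr (p + j)) = y (selector_addr (p + j))"
    using assms by (auto simp: ready_def selector_addr_def)
  define r1 where "r1 = r(5 := int j - 7, 7 := y j)"
  show ?thesis
  proof (cases "0 < y j")
    case False
    have "runs prog (31, r) (Suc (Suc (Suc (Suc (Suc (Suc (Suc (Suc 0)))))))) (31, r1(4 := int j - 1))"
      using assms r False
      by (intro runs_step) (simp_all add: prog_def r1_def fun_upd_twist runs_refl)
    then have "runs prog (31, r) (6 * p + 20) (31, r1(4 := int j - 1))"
      by (rule runs_mono) simp
    moreover have "ready (r1(4 := int j - 1))" "(r1(4 := int j - 1)) 0 = int p"
        "(r1(4 := int j - 1)) 4 = int (j - 1)" "(r1(4 := int j - 1)) 3 =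
        flip_if_odd (if 0 < y j \<and> 0 < y (selector_addr (p + j)) then 1 else 0) (r 3)"
      using assms False by (simp_all add: ready_def r1_def flip_if_odd_def of_nat_diff)
    ultimately show ?thesis by blast
  next
    case True
    define r2 where "r2 = r1(5 := int (p + j), 6 := 7)"
    have "runs prog (31, r) (Suc (Suc (Suc (Suc (Suc (Suc (Suc 0))))))) (40, r2)"
      using assms r True
      by (intro runs_step) (simp_all add: prog_def r1_def r2_def fun_upd_twist runs_refl)
    moreover have "0 < p + j" "r2 1 = 1" "r2 2 = 16" "r2 5 = int (p + j)"
      using assms r by (simp_all add: r1_def r2_def)
    from runs_divide[OF this] obtain c where "runs prog (40, r2) (3 * (p + j))
        (43, r2(5 := c, 6 := r2 6 + int ((p + j + 15) div 16)))" ..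
    ultimately have to_43: "runs prog (31, r) (Suc (Suc (Suc (Suc (Suc (Suc (Suc 0)))))) + 3 * (p + j))
        (43, r2(5 := c, 6 := r2 6 + int ((p + j + 15) div 16)))"
      by (rule runs_trans)
    define r3 where "r3 = r2(5 := c, 6 := int (selector_addr (p + j)))"
    have "r2(5 := c, 6 := r2 6 + int ((p + j + 15) div 16)) = r3"
      by (simp add: r2_def r3_def selector_addr_def)
    note to_43 = to_43[unfolded this]
    have r3: "r3 1 = 1" "r3 3 = r 3" "r3 4 = int j" "r3 6 = int (selector_addr (p + j))"
        "r3 (selector_addr (p + j)) = y (selector_addr (p + j))"
      using r assms by (auto simp: r3_def r2_def r1_def selector_addr_def)
    define b where "b \<longleftrightarrow> 0 < y (selector_addr (p + j))"
    define r4 where "r4 = r3(7 := y (selector_addr (p + j)),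
        3 := if b then 1 - r 3 else r 3, 4 := int j - 1)"
    have "runs prog (43, r3) (Suc (Suc (Suc (Suc (Suc 0))))) (31, r4)"
    proof (cases b)
      case True
      then show ?thesis
        using r3 unfolding b_def r4_def
        by (intro runs_step) (simp_all add: prog_def fun_upd_twist runs_refl)
    next
      case False
      then have "r3(7 := y (selector_addr (p + j)), 4 := int j - 1) = r4"
        using r3(2) by (auto simp: r4_def)
      moreover have "r4 1 = 1" using r3(1) by (simp add: r4_def)
      ultimately show ?thesis
        using r3 False unfolding b_def
        by (intro runs_step) (simp_all add: prog_def runs_refl)
    qed
    from runs_trans[OF to_43 this] have "runs prog (31, r) (6 * p + 20) (31, r4)"
      by (rule runs_mono) (use assms in simp)
    moreover have "ready r4" "r4 0 = int p" "r4 4 = int (j - 1)"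
      using assms by (simp_all add: ready_def r4_def r3_def r2_def r1_def of_nat_diff)
    moreover have "r4 3 = flip_if_odd (if 0 < y j \<and> 0 < y (selector_addr (p + j)) then 1 else 0) (r 3)"
      using True by (simp add: r4_def flip_if_odd_def b_def)
    ultimately show ?thesis by blast
  qed
qed

lemma runs_inner:
  assumes "ready r" "r 0 = int p" "r 4 = int j" "7 \<le> j" "j < p"
  shows "\<exists>r'. runs prog (31, r) (j * (6 * p + 20)) (49, r') \<and> ready r' \<and> r' 0 = int p \<and>
    r' 3 = flip_if_odd (card (row p j)) (r 3)"
  using assms
proof (induction j arbitrary: r)
  case (Suc j)
  show ?case
  proof (cases "Suc j = 7")
    case True
    have r: "r 1 = 1" "r 4 = 7" using Suc.prems True by (simp_all add: ready_def)
    have "runs prog (31, r) (Suc (Suc (Suc (Suc 0)))) (49, r(5 := 0))"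
      using r by (intro runs_step) (simp_all add: prog_def runs_refl)
    then have "runs prog (31, r) (Suc j * (6 * p + 20)) (49, r(5 := 0))"
      by (rule runs_mono) simp
    moreover have "row p (Suc j) = {}" using True by (auto simp: row_def)
    then have "(r(5 := 0)) 3 = flip_if_odd (card (row p (Suc j))) (r 3)"
      by (simp add: flip_if_odd_def)
    moreover have "ready (r(5 := 0))" "(r(5 := 0)) 0 = int p"
      using Suc.prems by (simp_all add: ready_def)
    ultimately show ?thesis by blast
  next
    case False
    define b where "b \<longleftrightarrow> 0 < y (Suc j) \<and> 0 < y (selector_addr (p + Suc j))"
    obtain r1 where r1: "runs prog (31, r) (6 * p + 20) (31, r1)" "ready r1" "r1 0 = int p"
        "r1 4 = int j" "r1 3 = flip_if_odd (if b then 1 else 0) (r 3)"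
      using runs_inner_body[of r p "Suc j"] Suc.prems False unfolding b_def by auto
    obtain r2 where r2: "runs prog (31, r1) (j * (6 * p + 20)) (49, r2)" "ready r2" "r2 0 = int p"
        "r2 3 = flip_if_odd (card (row p j)) (r1 3)"
      using Suc.IH[OF r1(2-4)] Suc.prems False by auto
    have "row p (Suc j) = (if b then insert (Suc j) (row p j) else row p j)"
      using Suc.prems(4) False by (auto simp: row_def b_def le_Suc_eq)
    moreover have "Suc j \<notin> row p j" by (simp add: row_def)
    ultimately have "card (row p (Suc j)) = card (row p j) + (if b then 1 else 0)" by simp
    moreover have "runs prog (31, r) (Suc j * (6 * p + 20)) (49, r2)"
      using runs_trans[OF r1(1) r2(1)] by simp
    moreover have "r2 3 = flip_if_odd (card (row p j) + (if b then 1 else 0)) (r 3)"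
      unfolding r2(4) r1(5) by (rule flip_if_odd_add)
    ultimately show ?thesis using r2(2,3) by metis
  qed
qed simp

lemma runs_outer_body:
  assumes "ready r" "r 0 = int p" "7 < p" "y p \<le> 1"
  shows "\<exists>r'. runs prog (24, r) (p * (6 * p + 20) + 10) (49, r') \<and> ready r' \<and> r' 0 = int p \<and>
    r' 3 = flip_if_odd (if 0 < y p then card (row p (p - 1)) else 0) (r 3)"
proof -
  have r: "r 1 = 1" "r p = y p" using assms by (auto simp: ready_def)
  show ?thesis
  proof (cases "0 < y p")
    case False
    have "runs prog (24, r) (Suc (Suc (Suc (Suc (Suc (Suc 0)))))) (49, r(7 := y p))"
      using assms r False
      by (intro runs_step) (simp_all add: prog_def runs_refl)
    then have "runs prog (24, r) (p * (6 * p + 20) + 10) (49, r(7 := y p))"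
      by (rule runs_mono) simp
    moreover have "ready (r(7 := y p))" "(r(7 := y p)) 0 = int p" "(r(7 := y p)) 3 =
        flip_if_odd (if 0 < y p then card (row p (p - 1)) else 0) (r 3)"
      using assms False by (simp_all add: ready_def flip_if_odd_def)
    ultimately show ?thesis by blast
  next
    case True
    define r1 where "r1 = r(7 := y p, 4 := int p - 1)"
    have to_31: "runs prog (24, r) (Suc (Suc (Suc (Suc (Suc (Suc 0)))))) (31, r1)"
      using assms r True
      by (intro runs_step) (simp_all add: prog_def r1_def runs_refl)
    have "ready r1" "r1 0 = int p" "r1 4 = int (p - 1)" "7 \<le> p - 1" "p - 1 < p"
      using assms by (auto simp: r1_def ready_def of_nat_diff)
    then obtain r2 where r2: "runs prog (31, r1) ((p - 1) * (6 * p + 20)) (49, r2)" "ready r2"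
        "r2 0 = int p" "r2 3 = flip_if_odd (card (row p (p - 1))) (r1 3)"
      using runs_inner by blast
    have "(p - 1) * (6 * p + 20) \<le> p * (6 * p + 20)" by (rule mult_le_mono1) simp
    then have "Suc (Suc (Suc (Suc (Suc (Suc 0))))) + (p - 1) * (6 * p + 20) \<le> p * (6 * p + 20) + 10"
      by linarith
    with runs_trans[OF to_31 r2(1)] have "runs prog (24, r) (p * (6 * p + 20) + 10) (49, r2)"
      by (rule runs_mono)
    moreover have "r2 3 = flip_if_odd (if 0 < y p then card (row p (p - 1)) else 0) (r 3)"
      using r2(4) True by (simp add: r1_def)
    ultimately show ?thesis using r2(2,3) by blast
  qed
qed

text \<open>Multilinearity is checked during the same descent: the first exponent above 1 leads to
  the rejecting exit.\<close>

lemma runs_outer: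
  assumes "ready r" "r 0 = int p" "7 < p"
  shows "if \<forall>q\<in>{8..p}. y q \<le> 1
    then \<exists>r'. runs prog (24, r) (p * (p * (6 * p + 20) + 20)) (53, r') \<and> r' 1 = 1 \<and>
      r' 3 = flip_if_odd (card (rows p)) (r 3)
    else \<exists>r'. runs prog (24, r) (p * (p * (6 * p + 20) + 20)) (55, r') \<and> r' 1 = 1"
  using assms
proof (induction p arbitrary: r)
  case (Suc p)
  define b where "b = p * (6 * p + 20) + 20"
  define b' where "b' = Suc p * (6 * Suc p + 20) + 20"
  have bb: "p * b + b' \<le> Suc p * b'"
  proof -
    have "b \<le> b'" unfolding b_def b'_def by (intro add_mono mult_le_mono) simp_all
    then show ?thesis by simp
  qed
  show ?case
  proof (cases "y (Suc p) \<le> 1")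
    case False
    have r: "r 1 = 1" "r (Suc p) = y (Suc p)" using Suc.prems by (auto simp: ready_def)
    have "runs prog (24, r) (Suc (Suc (Suc 0))) (55, r(7 := y (Suc p) - 1))"
      using Suc.prems r False
      by (intro runs_step) (simp_all add: prog_def runs_refl nat_add_distrib)
    then have "runs prog (24, r) (Suc p * b') (55, r(7 := y (Suc p) - 1))"
      by (rule runs_mono) (simp add: b'_def)
    moreover have "\<not> (\<forall>q\<in>{8..Suc p}. y q \<le> 1)" using False Suc.prems(3) by auto
    moreover have "(r(7 := y (Suc p) - 1)) 1 = 1" using r by simp
    ultimately show ?thesis
      unfolding b'_def[symmetric] by (simp only: if_False) blast
  next
    case True
    obtain r1 where r1: "runs prog (24, r) (Suc p * (6 * Suc p + 20) + 10) (49, r1)" "ready r1"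
        "r1 0 = int (Suc p)"
        "r1 3 = flip_if_odd (if 0 < y (Suc p) then card (row (Suc p) p) else 0) (r 3)"
      using runs_outer_body[OF Suc.prems True] by auto
    define r2 where "r2 = r1(0 := int p, 7 := int p - 7)"
    have r2: "ready r2" "r2 1 = 1" "r2 3 = r1 3" "r2 0 = int p"
      using r1 by (auto simp: ready_def r2_def)
    have step: "runs prog (49, r1) (Suc (Suc (Suc (Suc 0)))) (if 7 < p then 24 else 53, r2)"
      using r1(3) r2(2) r1(2) unfolding r2_def ready_def
      by (intro runs_step) (simp_all add: prog_def runs_refl)
    have to_24: "runs prog (24, r) b' (if 7 < p then 24 else 53, r2)"
      by (rule runs_mono[OF runs_trans[OF r1(1) step]]) (simp add: b'_def)
    define base where "base = {q \<in> {8..p}. 0 < y q}"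
    have "{q \<in> {8..Suc p}. 0 < y q} = (if 0 < y (Suc p) then insert (Suc p) base else base)"
      using Suc.prems(3) by (auto simp: base_def le_Suc_eq)
    moreover have "Suc p \<notin> base" "finite base" by (auto simp: base_def)
    ultimately have card_rows: "card (rows (Suc p)) =
        card (rows p) + (if 0 < y (Suc p) then card (row (Suc p) p) else 0)"
      unfolding rows_def base_def[symmetric] by simp
    have all: "(\<forall>q\<in>{8..Suc p}. y q \<le> 1) \<longleftrightarrow> (\<forall>q\<in>{8..p}. y q \<le> 1)"
      using True Suc.prems(3) by (auto simp: le_Suc_eq)
    show ?thesis
    proof (cases "7 < p")
      case False
      then have "rows p = {}" by (auto simp: rows_def)
      moreover have "runs prog (24, r) (Suc p * b') (53, r2)"
        by (rule runs_mono[of _ _ b']) (use to_24 False in simp_all)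
      moreover have "\<forall>q\<in>{8..p}. y q \<le> 1" using False by auto
      moreover have "r2 3 = flip_if_odd (card (rows (Suc p))) (r 3)"
        unfolding r2(3) r1(4) card_rows \<open>rows p = {}\<close> by simp
      ultimately show ?thesis
        using r2(2) unfolding all b'_def[symmetric] by (subst if_P) blast+
    next
      case 7: True
      have mono: "runs prog (24, r) (Suc p * b') s" if "runs prog (24, r2) (p * b) s" for s
        by (rule runs_mono[OF runs_trans[OF _ that] bb[unfolded add.commute[of "p * b"]]])
          (use to_24 7 in simp)
      show ?thesis
      proof (cases "\<forall>q\<in>{8..p}. y q \<le> 1")
        case ok: True
        obtain r3 where r3: "runs prog (24, r2) (p * b) (53, r3)" "r3 1 = 1"
            "r3 3 = flip_if_odd (card (rows p)) (r2 3)"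
          using Suc.IH[OF r2(1,4) 7, unfolded if_P[OF ok]] unfolding b_def by blast
        have "r3 3 = flip_if_odd (card (rows (Suc p))) (r 3)"
          unfolding r3(3) r2(3) r1(4) card_rows by (rule flip_if_odd_add)
        then show ?thesis
          using mono[OF r3(1)] r3(2) unfolding all b'_def[symmetric] if_P[OF ok] by blast
      next
        case bad: False
        obtain r3 where r3: "runs prog (24, r2) (p * b) (55, r3)" "r3 1 = 1"
          using Suc.IH[OF r2(1,4) 7, unfolded if_not_P[OF bad]] unfolding b_def by blast
        then show ?thesis
          using mono[OF r3(1)] r3(2) unfolding all b'_def[symmetric] if_not_P[OF bad] by blast
      qed
    qed
  qed
qed simp

end

section \<open>Initial memory, correctness and running time\<close>

lemma selector_addr_Suc: "selector_addr (Suc i + Suc j) = Suc (selector (i + j))"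
  by (simp add: selector_addr_def selector_def)

lemma ram_outputs_withinI:
  assumes "runs P s T (pc, r)" "length P \<le> pc" "r 1 > 0" "q = of_int (r 0) / of_int (r 1)"
  shows "ram_outputs_within P s T q"
  using assms unfolding runs_def ram_outputs_within_def by blast

locale prog_input =
  fixes n :: nat and m :: monomial
  assumes n: "0 < n" and m: "monomial_in n m"
begin

definition input :: "nat \<Rightarrow> int" where
  "input = snd (ram_input n m)"

text \<open>Memory during the relocation: \<open>stage k\<close> has copies of the input registers 1
  to k + 1 from address 32n on. The originals stay in place, except that register 1 now holds the
  constant 1.\<close>

definition stage :: "nat \<Rightarrow> nat \<Rightarrow> int" where
  "stage k a = (if a = 0 then int (32 * n + k) else if a = 1 then 1
    else if 32 * n \<le> a \<and> a \<le> 32 * n + k then input (a - 32 * n + 1) else input a)"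

sublocale prog_data "stage 6" .

lemma lookup_beyond: "n \<le> i \<Longrightarrow> Poly_Mapping.lookup m i = 0"
  using m by (force simp: monomial_in_def in_keys_iff)

lemma input_simps: "input 0 = int n" "0 < a \<Longrightarrow> input a = int (Poly_Mapping.lookup m (a - 1))"
  by (auto simp: input_def ram_input_def lookup_beyond)

lemma stage_low: "7 < a \<Longrightarrow> a < 32 * n \<Longrightarrow> stage 6 a = int (Poly_Mapping.lookup m (a - 1))"
  by (simp add: stage_def input_simps)

lemma stage_high: "i \<le> 6 \<Longrightarrow> stage 6 (32 * n + i) = int (Poly_Mapping.lookup m i)"
  using n by (simp add: stage_def input_simps)

lemma runs_stage_0: "runs prog (ram_input n m) 8 (11, stage 0)"
proof -
  have eq: "input(nat (32 * int n) := input (Suc 0), 0 := 32 * int n, Suc 0 := 1) = stage 0"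
    using n by (auto simp: stage_def fun_eq_iff)
  have "ram_input n m = (0, input)" by (simp add: input_def ram_input_def)
  moreover have "runs prog (0, input) (Suc (Suc (Suc (Suc (Suc (Suc (Suc (Suc 0)))))))) (11, stage 0)"
    using n unfolding eq[symmetric]
    by (intro runs_step) (simp_all add: prog_def input_simps(1) runs_refl fun_upd_twist)
  ultimately show ?thesis by (simp add: numeral_eq_Suc)
qed

lemma runs_stage_Suc:
  assumes "k < 6"
  shows "runs prog (11 + 2 * k, stage k) 2 (11 + 2 * Suc k, stage (Suc k))"
proof -
  have eq: "(stage k)(0 := int (32 * n + Suc k), nat (int (32 * n + Suc k)) := input (k + 2)) = stage (Suc k)"
    unfolding nat_int using n by (auto simp: stage_def fun_eq_iff)
  have "prog ! (11 + 2 * k) = Add 0 0 1" "prog ! (12 + 2 * k) = Store 0 (k + 2)"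
    using assms by (auto simp: prog_def less_Suc_eq numeral_eq_Suc)
  moreover have "stage k 0 = int (32 * n + k)" "stage k 1 = 1" "stage k (k + 2) = input (k + 2)"
    using n assms by (auto simp: stage_def)
  ultimately have "runs prog (11 + 2 * k, stage k) (Suc (Suc 0)) (13 + 2 * k, stage (Suc k))"
    using assms unfolding eq[symmetric]
    by (intro runs_step) (simp_all add: runs_refl add.commute)
  then show ?thesis by (simp add: numeral_eq_Suc)
qed

lemma runs_setup: "runs prog (ram_input n m) 21 (24, (stage 6)(2 := 16))"
proof -
  have "runs prog (ram_input n m) (8 + 2 * k) (11 + 2 * k, stage k)" if "k \<le> 6" for k
    using that
  proof (induction k)
    case 0
    then show ?case using runs_stage_0 by simp
  next
    case (Suc k)
    then show ?case using runs_trans[OF Suc.IH runs_stage_Suc[of k]] by simp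
  qed
  from this[of 6] have "runs prog (ram_input n m) 20 (23, stage 6)" by simp
  moreover have "runs prog (23, stage 6) (Suc 0) (24, (stage 6)(2 := 16))"
    by (intro runs_step) (simp_all add: prog_def runs_refl)
  ultimately have "runs prog (ram_input n m) (20 + Suc 0) (24, (stage 6)(2 := 16))"
    by (rule runs_trans)
  then show ?thesis by simp
qed

text \<open>The range contains every exponent: indices 0 to 6 at their moved addresses, the others
  in their own registers. The addresses in between hold 0.\<close>

lemma multilinear_iff: "(\<forall>q\<in>{8..32 * n + 6}. stage 6 q \<le> 1) \<longleftrightarrow> (\<forall>i. Poly_Mapping.lookup m i \<le> 1)"
proof (intro iffI allI ballI)
  fix i assume *: "\<forall>q\<in>{8..32 * n + 6}. stage 6 q \<le> 1"
  consider "i < 7" | "7 \<le> i" "i < n" | "n \<le> i" by linarith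
  then show "Poly_Mapping.lookup m i \<le> 1"
  proof cases
    case 1
    then show ?thesis using *[rule_format, of "32 * n + i"] stage_high[of i] n by simp
  next
    case 2
    then show ?thesis using *[rule_format, of "Suc i"] stage_low[of "Suc i"] by simp
  next
    case 3
    then show ?thesis using lookup_beyond by simp
  qed
next
  fix q assume *: "\<forall>i. Poly_Mapping.lookup m i \<le> 1" and q: "q \<in> {8..32 * n + 6}"
  show "stage 6 q \<le> 1"
  proof (cases "q < 32 * n")
    case True
    then show ?thesis using stage_low[of q] q * by simp
  next
    case False
    then obtain i where "q = 32 * n + i" by (metis le_Suc_ex not_le)
    then show ?thesis using stage_high[of i] q *[rule_format, of i] by simp
  qed
qed

lemma stage_pos_iff: "7 < a \<Longrightarrow> a < 32 * n \<Longrightarrow> 0 < stage 6 a \<longleftrightarrow> a - 1 \<in> Poly_Mapping.keys m"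
  by (simp add: stage_low in_keys_iff)

text \<open>The moved exponents never enter a counted pair: an address of at least 32n pushes the
  selector address beyond n, into memory that holds 0.\<close>

lemma rows_eq: "rows (32 * n + 6) = map_prod Suc Suc ` active_pairs (Poly_Mapping.keys m)"
proof (intro equalityI subsetI)
  fix c assume c: "c \<in> rows (32 * n + 6)"
  obtain q q' where [simp]: "c = (q, q')" by (cases c)
  have q: "8 \<le> q" "q \<le> 32 * n + 6" "8 \<le> q'" "q' < q" "0 < stage 6 q" "0 < stage 6 q'"
      "0 < stage 6 (selector_addr (q + q'))"
    using c by (auto simp: rows_def row_def)
  \<comment> \<open>Selector addresses are at most 4n + 8 < 32n, so no moved exponent is read as a
    selector.\<close>
  have "q + q' + 15 < (4 * n + 2) * 16" using q(2,4) by simp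
  then have "(q + q' + 15) div 16 < 4 * n + 2" by (rule less_mult_imp_div_less)
  moreover have "0 < (q + q' + 15) div 16" using q(1) by (simp add: div_greater_zero_iff)
  ultimately have sel: "7 < selector_addr (q + q')" "selector_addr (q + q') < 32 * n"
    using n by (simp_all add: selector_addr_def)
  then have key: "selector_addr (q + q') - 1 \<in> Poly_Mapping.keys m"
    using q(7) stage_pos_iff by blast
  then have "selector_addr (q + q') \<le> n"
    using m by (auto simp: monomial_in_def)
  then have "(q + q' + 15) div 16 \<le> n" by (simp add: selector_addr_def)
  then have "q + q' < 16 * n + 16"
    using mod_less_divisor[of 16 "q + q' + 15"] div_mult_mod_eq[of "q + q' + 15" 16] by linarith
  then have "q < 32 * n" using q(3) n by linarith
  then have keys: "q - 1 \<in> Poly_Mapping.keys m" "q' - 1 \<in> Poly_Mapping.keys m"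
    using q stage_pos_iff[of q] stage_pos_iff[of q'] by auto
  have "selector_addr (q + q') - 1 = selector (q - 1 + (q' - 1))"
    using selector_addr_Suc[of "q - 1" "q' - 1"] q(1,3) by simp
  then have "(q - 1, q' - 1) \<in> active_pairs (Poly_Mapping.keys m)"
    using key keys q(1,3,4) by (auto simp: active_pairs_def)
  moreover have "c = map_prod Suc Suc (q - 1, q' - 1)" using q(1,3) by simp
  ultimately show "c \<in> map_prod Suc Suc ` active_pairs (Poly_Mapping.keys m)" by blast
next
  fix c assume "c \<in> map_prod Suc Suc ` active_pairs (Poly_Mapping.keys m)"
  then obtain i j where c: "c = (Suc i, Suc j)" and ij: "i \<in> Poly_Mapping.keys m"
      "j \<in> Poly_Mapping.keys m" "7 \<le> j" "j < i" "selector (i + j) \<in> Poly_Mapping.keys m"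
    by (auto simp: active_pairs_def)
  have less: "i < n" "j < n" "selector (i + j) < n"
    using m ij by (auto simp: monomial_in_def)
  have "1 \<le> (i + j + 17) div 16" by (simp add: div_greater_zero_iff Suc_le_eq)
  then have "7 < Suc (selector (i + j))" by (simp add: selector_def)
  then have "0 < stage 6 (Suc i)" "0 < stage 6 (Suc j)" "0 < stage 6 (selector_addr (Suc i + Suc j))"
    unfolding selector_addr_Suc
    using ij less stage_pos_iff[of "Suc i"] stage_pos_iff[of "Suc j"] stage_pos_iff[of "Suc (selector (i + j))"]
    by auto
  then show "c \<in> rows (32 * n + 6)"
    using ij less by (auto simp: c rows_def row_def)
qed

lemma card_rows: "card (rows (32 * n + 6)) = card (active_pairs (Poly_Mapping.keys m))"
  unfolding rows_eq by (intro card_image inj_on_subset[OF prod.inj_map[OF inj_Suc inj_Suc]]) simp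

text \<open>The extra 23 steps are 21 for the set-up and 2 for the exit. Register 3 starts with the
  linear term, register 0 receives one minus the parity, and register 1 still holds 1 as the
  denominator.\<close>

lemma prog_correct:
  defines "p \<equiv> 32 * n + 6"
  shows "ram_outputs_within prog (ram_input n m) (p * (p * (6 * p + 20) + 20) + 23)
    (Poly_Mapping.lookup (hard_poly n) m)"
proof -
  define r where "r = (stage 6)(2 := 16)"
  define T where "T = p * (p * (6 * p + 20) + 20)"
  have ready: "ready r" "r 0 = int p" "7 < p"
    using n by (simp_all add: r_def ready_def p_def stage_def)
  have r3: "r 3 = int (Poly_Mapping.lookup m 2)"
    using n by (simp add: r_def stage_def input_simps)
  note outer = runs_outer[OF ready, unfolded p_def multilinear_iff card_rows, folded p_def, folded T_def]
  have finish: "ram_outputs_within prog (ram_input n m) (T + 23) (of_int (s 0))"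
    if "runs prog (24, r) T s0" "runs prog s0 2 (56, s)" "s 1 = 1" for s0 s
    using runs_trans[OF runs_trans[OF runs_setup[folded r_def] that(1)] that(2)] that(3)
    by (intro ram_outputs_withinI[of _ _ _ 56 s]) (auto elim: runs_mono)
  show ?thesis
  proof (cases "\<forall>i. Poly_Mapping.lookup m i \<le> 1")
    case False
    then obtain r' where r': "runs prog (24, r) T (55, r')" "r' 1 = 1"
      using outer unfolding if_not_P[OF False] by blast
    have "runs prog (55, r') (Suc (Suc 0)) (56, r'(0 := 0))"
      by (rule runs_mono[of _ _ "Suc 0"], intro runs_step) (simp_all add: prog_def runs_refl)
    then have "ram_outputs_within prog (ram_input n m) (T + 23) (of_int ((r'(0 := 0)) 0))"
      using finish[OF r'(1), of "r'(0 := 0)"] r'(2) by (simp add: numeral_2_eq_2)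
    moreover have "Poly_Mapping.lookup (hard_poly n) m = 0"
      using False by (simp add: lookup_hard_poly)
    ultimately show ?thesis by (simp add: T_def)
  next
    case True
    define x where "x = Poly_Mapping.keys m"
    obtain r' where r': "runs prog (24, r) T (53, r')" "r' 1 = 1"
        "r' 3 = flip_if_odd (card (active_pairs x)) (r 3)"
      using outer unfolding if_P[OF True] x_def by blast
    have "runs prog (53, r') (Suc (Suc 0)) (56, r'(0 := 1 - r' 3))"
      using r'(2) by (intro runs_step) (simp_all add: prog_def runs_refl)
    then have out: "ram_outputs_within prog (ram_input n m) (T + 23) (of_int ((r'(0 := 1 - r' 3)) 0))"
      using finish[OF r'(1), of "r'(0 := 1 - r' 3)"] r'(2) by (simp add: numeral_2_eq_2)
    have "x \<subseteq> {..<n}" using m by (simp add: x_def monomial_in_def)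
    then have "Poly_Mapping.lookup (hard_poly n) m = (if even (form_value x) then 1 else 0)"
      using True by (simp add: lookup_hard_poly hard_family_def x_def)
    moreover have "r 3 = (if 2 \<in> x then 1 else 0)"
      using r3 True[rule_format, of 2] by (auto simp: x_def in_keys_iff)
    then have "1 - r' 3 = (if even (form_value x) then 1 else 0)"
      using r'(3) by (auto simp: flip_if_odd_def form_value_def)
    ultimately show ?thesis using out by (simp add: T_def split: if_splits)
  qed
qed

end

lemma explicit_hard_poly: "explicit hard_poly"
  unfolding explicit_def
proof (intro exI allI impI)
  fix n m assume m: "monomial_in n m"
  show "ram_outputs_within prog (ram_input n m) (1000000 * n ^ 3 + 1000000)
      (Poly_Mapping.lookup (hard_poly n) m)"
  proof (cases "n = 0")
    case False
    then interpret prog_input n m using m by unfold_locales auto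
    define p where "p = 32 * n + 6"
    \<comment> \<open>For positive n, 6 \<le> 6n gives the 38. The resulting factor 38 * (38 * 248 +
      20) = 358872 is rounded up to 1000000.\<close>
    have p: "p \<le> 38 * n" using False by (simp add: p_def)
    then have "p * (p * (6 * p + 20) + 20) \<le> 38 * n * (38 * n * (6 * (38 * n) + 20 * n) + 20 * n * n)"
      using False by (intro mult_le_mono add_mono) auto
    also have "\<dots> = (38 * (38 * 248 + 20)) * n ^ 3"
      by (simp add: power3_eq_cube algebra_simps)
    also have "\<dots> \<le> 1000000 * n ^ 3" by (intro mult_le_mono1) simp
    finally have "p * (p * (6 * p + 20) + 20) + 23 \<le> 1000000 * n ^ 3 + 1000000" by simp
    then show ?thesis
      using prog_correct[folded p_def] unfolding ram_outputs_within_def by (meson le_trans)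
  next
    case True
    \<comment> \<open>With n = 0 the moved addresses would fall onto the working registers, so the
      program has a separate exit. The only monomial is 1, and the form vanishes on the empty
      set.\<close>
    then have keys: "Poly_Mapping.keys m = {}" using m by (simp add: monomial_in_def)
    then have "m = 0" by simp
    moreover have "{} \<in> hard_family 0"
      by (simp add: hard_family_def form_value_def active_pairs_def)
    ultimately have val: "Poly_Mapping.lookup (hard_poly n) m = 1"
      using True by (simp add: lookup_hard_poly)
    obtain r where r: "ram_input n m = (0, r)" "r 0 = 0" using True by (simp add: ram_input_def)
    have "runs prog (0, r) (Suc (Suc (Suc (Suc 0)))) (56, r(0 := 1, 1 := 1))"
      using r(2) by (intro runs_step) (simp_all add: prog_def runs_refl)
    then have "runs prog (ram_input n m) (1000000 * n ^ 3 + 1000000) (56, r(0 := 1, 1 := 1))"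
      unfolding r(1) by (rule runs_mono) simp
    then show ?thesis
      by (rule ram_outputs_withinI) (simp_all add: val)
  qed
qed

lemma mpoly_in_hard_poly: "mpoly_in n (hard_poly n)"
  by (auto simp: mpoly_in_def monomial_in_def in_keys_iff[of _ "hard_poly n"] lookup_hard_poly
      hard_family_def split: if_splits)

lemma monotone_hard_poly: "monotone_poly (hard_poly n)"
  by (simp add: monotone_poly_def lookup_hard_poly)

lemma multilinear_hard_poly: "multilinear (hard_poly n)"
  by (auto simp: multilinear_def in_keys_iff lookup_hard_poly split: if_splits)

section \<open>The lower bound\<close>

lemma ex_multilinear_monomial:
  assumes "finite x"
  shows "\<exists>m :: monomial. (\<forall>i. Poly_Mapping.lookup m i \<le> 1) \<and> Poly_Mapping.keys m = x"
proof (intro exI conjI allI)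
  let ?m = "\<Sum>i\<in>x. Poly_Mapping.single i (1 :: nat)"
  have lookup: "Poly_Mapping.lookup ?m j = (if j \<in> x then 1 else 0)" for j
    using assms by (simp add: lookup_sum lookup_single when_def)
  show "Poly_Mapping.lookup ?m i \<le> 1" for i unfolding lookup by simp
  show "Poly_Mapping.keys ?m = x" unfolding set_eq_iff in_keys_iff lookup by simp
qed

text \<open>A multilinear monomial is determined by its variables, so equal supports in
  \<open>f1\<close> and \<open>f2\<close> come from the same monomial, whose two coefficients are
  multiplied.\<close>

lemma supports_hadamard_hard_poly:
  fixes f1 f2 :: "real mpoly"
  assumes "multilinear f1" "multilinear f2"
    and eq: "Poly_Mapping.map of_rat (hard_poly n) = hadamard f1 f2"
  shows "supports f1 \<inter> supports f2 = hard_family n"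
proof -
  have coeff: "Poly_Mapping.lookup f1 m * Poly_Mapping.lookup f2 m \<noteq> 0 \<longleftrightarrow>
      (\<forall>i. Poly_Mapping.lookup m i \<le> 1) \<and> Poly_Mapping.keys m \<in> hard_family n" for m
  proof -
    have "Poly_Mapping.lookup f1 m * Poly_Mapping.lookup f2 m = of_rat (Poly_Mapping.lookup (hard_poly n) m)"
      using arg_cong[OF eq, of "\<lambda>f. Poly_Mapping.lookup f m"]
      by (simp add: hadamard.rep_eq map.rep_eq when_def split: if_splits)
    then show ?thesis by (simp add: lookup_hard_poly)
  qed
  show ?thesis
  proof (intro equalityI subsetI)
    fix x assume "x \<in> supports f1 \<inter> supports f2"
    then obtain m1 m2 where m: "m1 \<in> Poly_Mapping.keys f1" "m2 \<in> Poly_Mapping.keys f2"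
        "x = Poly_Mapping.keys m1" "x = Poly_Mapping.keys m2"
      by (auto simp: supports_def)
    have "m1 = m2"
      using m assms(1,2) by (intro keys_multilinear_inject) (auto simp: multilinear_def)
    then show "x \<in> hard_family n"
      using m coeff[of m1] by (simp add: in_keys_iff)
  next
    fix x assume x: "x \<in> hard_family n"
    then have "finite x" by (auto simp: hard_family_def intro: finite_subset)
    then obtain m :: monomial where "\<forall>i. Poly_Mapping.lookup m i \<le> 1" "Poly_Mapping.keys m = x"
      using ex_multilinear_monomial by blast
    then show "x \<in> supports f1 \<inter> supports f2"
      using x coeff[of m] by (auto simp: supports_def in_keys_iff)
  qed
qed

lemma circuit_size_product_bound:
  fixes C1 C2 :: "real circuit"
  assumes n: "3 \<le> n" and k: "6 * (16 * k + (n div 8 + 8)) \<le> n"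
    and C1: "circuit_in n C1" "monotone_circuit C1" "multilinear (circuit_poly C1)" "mpoly_in n (circuit_poly C1)"
    and C2: "circuit_in n C2" "monotone_circuit C2" "multilinear (circuit_poly C2)" "mpoly_in n (circuit_poly C2)"
    and eq: "Poly_Mapping.map of_rat (hard_poly n) = hadamard (circuit_poly C1) (circuit_poly C2)"
  shows "2 ^ k \<le> 4 * (Suc (circuit_size C1) * Suc (circuit_size C2))"
proof -
  have "2 \<le> n" using n by simp
  obtain \<R>1 where \<R>1: "finite \<R>1" "card \<R>1 \<le> Suc (circuit_size C1)" "\<Union>\<R>1 = supports (circuit_poly C1)"
      "\<forall>R\<in>\<R>1. \<exists>Y. balanced n Y \<and> mix_closed Y R"
    using supports_cover[OF \<open>2 \<le> n\<close> C1] by blast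
  obtain \<R>2 where \<R>2: "finite \<R>2" "card \<R>2 \<le> Suc (circuit_size C2)" "\<Union>\<R>2 = supports (circuit_poly C2)"
      "\<forall>R\<in>\<R>2. \<exists>Y. balanced n Y \<and> mix_closed Y R"
    using supports_cover[OF \<open>2 \<le> n\<close> C2] by blast
  have "2 ^ k \<le> 4 * (card \<R>1 * card \<R>2)"
    using supports_hadamard_hard_poly[OF C1(3) C2(3) eq] \<R>1 \<R>2
    by (intro hard_family_cover_bound[OF n k]) auto
  also have "\<dots> \<le> 4 * (Suc (circuit_size C1) * Suc (circuit_size C2))"
    using \<R>1(2) \<R>2(2) by (intro mult_le_mono) auto
  finally show ?thesis .
qed

theorem theorem9:
  shows "\<exists>\<alpha>::real. \<alpha> > 0 \<and>
    (\<exists>F :: nat \<Rightarrow> rat mpoly. explicit F \<and>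
      (\<exists>N. \<forall>n\<ge>N.
        mpoly_in n (F n) \<and> monotone_poly (F n) \<and> multilinear (F n) \<and>
        \<not> (\<exists>(f1 :: real mpoly) (f2 :: real mpoly).
            mpoly_in n f1 \<and> monotone_poly f1 \<and> multilinear f1 \<and>
            mpoly_in n f2 \<and> monotone_poly f2 \<and> multilinear f2 \<and>
            Poly_Mapping.map of_rat (F n) = hadamard f1 f2 \<and>
            (\<exists>C1. circuit_in n C1 \<and> monotone_circuit C1 \<and> circuit_poly C1 = f1 \<and>
              real (circuit_size C1) < 2 powr (\<alpha> * real n)) \<and>
            (\<exists>C2. circuit_in n C2 \<and> monotone_circuit C2 \<and> circuit_poly C2 = f2 \<and>
              real (circuit_size C2) < 2 powr (\<alpha> * real n)))))"
proof (intro exI conjI allI impI notI)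
  show "explicit hard_poly" by (rule explicit_hard_poly)
next
  \<comment> \<open>The witnesses 1/1000 for \<alpha> and 20000 for the threshold are fixed by
    unification with the facts assumed and shown here.\<close>
  fix n :: nat assume n: "20000 \<le> n"
  show "mpoly_in n (hard_poly n)" by (rule mpoly_in_hard_poly)
  show "monotone_poly (hard_poly n)" by (rule monotone_hard_poly)
  show "multilinear (hard_poly n)" by (rule multilinear_hard_poly)
  \<comment> \<open>Since 6 * 16/400 + 6/8 = 0.99 < 1, this \<open>k\<close> fits the size condition
    for large n. Its growth n/400 exceeds the n/500 contributed by two circuits of size below
    \<open>B\<close>.\<close>
  define k where "k = n div 400"
  define B where "B = 2 powr (1 / 1000 * real n)"
  assume "\<exists>(f1 :: real mpoly) (f2 :: real mpoly).
            mpoly_in n f1 \<and> monotone_poly f1 \<and> multilinear f1 \<and>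
            mpoly_in n f2 \<and> monotone_poly f2 \<and> multilinear f2 \<and>
            Poly_Mapping.map of_rat (hard_poly n) = hadamard f1 f2 \<and>
            (\<exists>C1. circuit_in n C1 \<and> monotone_circuit C1 \<and> circuit_poly C1 = f1 \<and>
              real (circuit_size C1) < 2 powr (1 / 1000 * real n)) \<and>
            (\<exists>C2. circuit_in n C2 \<and> monotone_circuit C2 \<and> circuit_poly C2 = f2 \<and>
              real (circuit_size C2) < 2 powr (1 / 1000 * real n))"
  then obtain C1 C2 :: "real circuit" where
      C1: "circuit_in n C1" "monotone_circuit C1" "multilinear (circuit_poly C1)" "mpoly_in n (circuit_poly C1)"
    and C2: "circuit_in n C2" "monotone_circuit C2" "multilinear (circuit_poly C2)" "mpoly_in n (circuit_poly C2)"
    and eq: "Poly_Mapping.map of_rat (hard_poly n) = hadamard (circuit_poly C1) (circuit_poly C2)"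
    and size: "real (circuit_size C1) < B" "real (circuit_size C2) < B"
    unfolding B_def by blast
  have k: "400 * k \<le> n" "n < 400 * k + 400"
    using mod_less_divisor[of 400 n] div_mult_mod_eq[of n 400] unfolding k_def by linarith+
  have "6 * (16 * k + (e + 8)) \<le> n" if "8 * e \<le> n" for e
    using that n k(1) by (simp add: distrib_left)
  then have "6 * (16 * k + (n div 8 + 8)) \<le> n" by simp
  then have bound: "2 ^ k \<le> 4 * (Suc (circuit_size C1) * Suc (circuit_size C2))"
    using n by (intro circuit_size_product_bound[OF _ _ C1 C2 eq]) auto
  have "1 \<le> B" unfolding B_def by (intro ge_one_powr_ge_zero) auto
  then have "real (Suc (circuit_size C1)) \<le> 2 * B" "real (Suc (circuit_size C2)) \<le> 2 * B"
    using size by simp_all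
  then have "real (Suc (circuit_size C1)) * real (Suc (circuit_size C2)) \<le> (2 * B) * (2 * B)"
    using \<open>1 \<le> B\<close> by (intro mult_mono) auto
  moreover have "(2::real) ^ k \<le> 4 * (real (Suc (circuit_size C1)) * real (Suc (circuit_size C2)))"
    using of_nat_mono[OF bound, where 'a = real]
    by (simp only: of_nat_mult of_nat_power of_nat_numeral)
  \<comment> \<open>The factor 2^4 collects the 4 of the bound and the two factors 2 that absorb
    \<open>Suc\<close> into \<open>B\<close>.\<close>
  ultimately have "2 powr real k \<le> 2 powr 4 * (B * B)"
    by (simp add: powr_realpow)
  also have "B * B = 2 powr (real n / 500)"
    by (simp add: B_def flip: powr_add)
  finally have "2 powr real k \<le> 2 powr (4 + real n / 500)"
    by (simp only: powr_add)
  then have "real k \<le> 4 + real n / 500" by simp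
  moreover have "real n < 400 * real k + 400"
    using of_nat_less_iff[where 'a = real, THEN iffD2, OF k(2)] by simp
  ultimately show False using n by linarith
qed simp

end
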